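(* Let $N>1$ be an integer, $N_1=\lfloor \frac{N-1}{2}\rfloor$, $N_2=\lfloor \frac N2\rfloor$, and consider the congruence subgroups $\Gamma(N)<\Gamma_1(N)<\Gamma_0(N)<\Gamma(1)=SL_2(\mathbb Z)$. Let $T=\begin{pmatrix}1&1\\0&1\end{pmatrix}$, $S=\begin{pmatrix}0&-1\\1&0\end{pmatrix}$. \begin{enumerate} \item For $\Gamma_0(N)$, a fundamental list of right coset representatives is the list $\Theta_0$ consisting of $ST^i$ for $-N_1\le i\le N_2$, together with $ST^jST^m$ for $-N_1\le j\le N_2$ with $\gcd(j,N)>1$ and $0\le m\le M_j$ (with $M_j$ defined in the context). \item For $\Gamma_1(N)$, a fundamental list of right coset representatives is the list $\Theta_1$ consisting of: $ST^i$ for $-N_1\le i\le N_2$; $ST^jST^m$ for $-N_1\le j\le N_2$, $\gcd(j,N)>1$, $0\le m\le M_j$; $ST^kST^i$ for $-N_1\le k\le -2$ with $\gcd(k,N)=1$ and $-N_1\le i\le N_2$; $ST^kST^{\widetilde{(k^{-1}+j)}}ST^m$ for $k$ as in the previous item, $j,m$ as in the second item, where $k^{-1}$ is an integer which is an inverse of $k$ modulo $N$. \item For $\Gamma(N)$, a fundamental list of right coset representatives is $\{T^\ell\gamma \mid -N_1\le \ell\le N_2,\ \gamma\in\Theta_1\}$. \end{enumerate}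
   Context: $SL_2(\mathbb Z)$ acts on the upper half plane $\mathbb H=\{z:\operatorname{Im} z>0\}$ by Möbius transformations; $-I$ acts trivially. Let $D=\{z\in\mathbb H: |z|>1, |\operatorname{Re} z|<\tfrac12\}$. $\Gamma_0(N)$ (resp. $\Gamma_1(N)$, $\Gamma(N)$) is the set of matrices in $SL_2(\mathbb Z)$ congruent mod $N$ to $\begin{pmatrix}*&*\\0&*\end{pmatrix}$ (resp. $\begin{pmatrix}1&*\\0&1\end{pmatrix}$, resp. $I$). For a subgroup $\Gamma<\Gamma(1)$ of finite index, a list $\gamma_1,\dots,\gamma_n$ of elements of $\Gamma(1)$ is called a fundamental list of right coset representatives if $(\pm I)\Gamma\gamma_1,\dots,(\pm I)\Gamma\gamma_n$ are exactly the distinct right cosets of $(\pm I)\Gamma$ in $\Gamma(1)$ (each once), and the set $\operatorname{Int}\big(\bigcup_{i=1}^n\overline{\gamma_iD}\big)$ is connected, where closures and interiors are taken in $\mathbb H$. For $x\in\mathbb Z$, $\widetilde x$ denotes the unique integer with $\widetilde x\equiv x\pmod N$ and $-N_1\le\widetilde x\le N_2$. Definition of $M_j$: Let $P^1(\mathbb Z/N\mathbb Z)$ be the set of pairs $(a,b)\in(\mathbb Z/N\mathbb Z)^2$ with $\gcd(a,b,N)=1$ modulo the relation $(a,b)\sim(ua,ub)$ for $u\in(\mathbb Z/N\mathbb Z)^*$; write $(a:b)$ for the class. Let $H=\{(a:b)\in P^1(\mathbb Z/N\mathbb Z): \gcd(a,N)>1\}$. For $(a:b)\in H$ define $M(a:b)=\min\{m\in\mathbb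 Z_{\ge0}: \gcd(ma-b,N)=1\}$ (this is well defined and finite). For $(a:b)\in H$ let $c=M(a:b)a-b\in(\mathbb Z/N\mathbb Z)^*$ and define $\operatorname{pr}(a:b)=(ac^{-1},bc^{-1})\in(\mathbb Z/N\mathbb Z)^2$, with first component $\pi_1(\operatorname{pr}(a:b))=ac^{-1}$. For $j\in\mathbb Z/N\mathbb Z$ with $\gcd(j,N)>1$, set $M_j=\max\{M(a:b): (a:b)\in H,\ \pi_1(\operatorname{pr}(a:b))=j\}$ (the set is nonempty, so $M_j\ge 0$). For an integer $j$, $M_j$ means $M_{j \bmod N}$. *)

theory Defs
  imports "HOL-Analysis.Analysis" "HOL-Number_Theory.Residues"
begin

definition SL2Z :: "(int^2^2) monoid" where
  "SL2Z = \<lparr>carrier = {A. det A = 1}, mult = (**), one = mat 1\<rparr>"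

definition matT :: "int^2^2" where
  "matT = vector [vector [1, 1], vector [0, 1]]"

definition matS :: "int^2^2" where
  "matS = vector [vector [0, -1], vector [1, 0]]"

abbreviation T_pow :: "int \<Rightarrow> int^2^2" where
  "T_pow i \<equiv> matT [^]\<^bsub>SL2Z\<^esub> i"

definition Gamma0 :: "int \<Rightarrow> (int^2^2) set" where
  "Gamma0 N = {A \<in> carrier SL2Z. [A$2$1 = 0] (mod N)}"

definition Gamma1 :: "int \<Rightarrow> (int^2^2) set" where
  "Gamma1 N = {A \<in> carrier SL2Z. [A$1$1 = 1] (mod N) \<and> [A$2$1 = 0] (mod N) \<and> [A$2$2 = 1] (mod N)}"

definition GammaN :: "int \<Rightarrow> (int^2^2) set" where
  "GammaN N = {A \<in> carrier SL2Z. [A$1$1 = 1] (mod N) \<and> [A$1$2 = 0] (mod N) \<and>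
                                  [A$2$1 = 0] (mod N) \<and> [A$2$2 = 1] (mod N)}"

definition moebius :: "int^2^2 \<Rightarrow> complex \<Rightarrow> complex" where
  "moebius A z = (of_int (A$1$1) * z + of_int (A$1$2)) / (of_int (A$2$1) * z + of_int (A$2$2))"

definition upper_half_plane :: "complex set" where
  "upper_half_plane = {z. Im z > 0}"

definition fund_D :: "complex set" where
  "fund_D = {z \<in> upper_half_plane. cmod z > 1 \<and> \<bar>Re z\<bar> < 1/2}"

definition pm_I :: "(int^2^2) set \<Rightarrow> (int^2^2) set" where
  "pm_I \<Gamma> = {mat 1, - mat 1} <#>\<^bsub>SL2Z\<^esub> \<Gamma>"

text \<open>The standing assumption that \<open>\<Gamma>\<close> is a subgroup of finite index is part of the definition.
  Closures and interiors are relative to the upper half plane.\<close>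

definition fundamental_list :: "(int^2^2) set \<Rightarrow> (int^2^2) list \<Rightarrow> bool" where
  "fundamental_list \<Gamma> \<gamma>s \<longleftrightarrow>
     subgroup \<Gamma> SL2Z \<and> finite (rcosets\<^bsub>SL2Z\<^esub> \<Gamma>) \<and>
     set \<gamma>s \<subseteq> carrier SL2Z \<and>
     distinct (map (\<lambda>\<gamma>. pm_I \<Gamma> #>\<^bsub>SL2Z\<^esub> \<gamma>) \<gamma>s) \<and>
     set (map (\<lambda>\<gamma>. pm_I \<Gamma> #>\<^bsub>SL2Z\<^esub> \<gamma>) \<gamma>s) = rcosets\<^bsub>SL2Z\<^esub> (pm_I \<Gamma>) \<and>
     connected (top_of_set upper_half_plane interior_of
       (\<Union>\<gamma>\<in>set \<gamma>s. top_of_set upper_half_plane closure_of (moebius \<gamma> ` fund_D)))"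

text \<open>\<open>\<int>/N\<int>\<close> is \<open>residue_ring N\<close>, whose carrier is \<open>{0..N - 1}\<close>.
  The gcds below do not depend on the representative modulo \<open>N\<close>.\<close>

definition P1_pairs :: "int \<Rightarrow> (int \<times> int) set" where
  "P1_pairs N = {(a, b). a \<in> carrier (residue_ring N) \<and> b \<in> carrier (residue_ring N) \<and>
                         Gcd {a, b, N} = 1}"

definition P1_rel :: "int \<Rightarrow> ((int \<times> int) \<times> (int \<times> int)) set" where
  "P1_rel N = {((a, b), (a', b')). (a, b) \<in> P1_pairs N \<and> (a', b') \<in> P1_pairs N \<and>
     (\<exists>u \<in> Units (residue_ring N). a' = u \<otimes>\<^bsub>residue_ring N\<^esub> a \<and> b' = u \<otimes>\<^bsub>residue_ring N\<^esub> b)}"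

definition P1 :: "int \<Rightarrow> (int \<times> int) set set" where
  "P1 N = P1_pairs N // P1_rel N"

definition P1_H :: "int \<Rightarrow> (int \<times> int) set set" where
  "P1_H N = {C \<in> P1 N. \<exists>(a, b) \<in> C. gcd a N > 1}"

text \<open>The next two functions are given on representatives by expressions that are constant
  on each class in \<open>P1_H N\<close>; \<open>the_elem\<close> of the image is that common value.\<close>

definition P1_M :: "int \<Rightarrow> (int \<times> int) set \<Rightarrow> nat" where
  "P1_M N C = the_elem ((\<lambda>(a, b). LEAST m::nat. gcd (int m * a - b) N = 1) ` C)"

definition P1_pr :: "int \<Rightarrow> (int \<times> int) set \<Rightarrow> int \<times> int" where
  "P1_pr N C = the_elem ((\<lambda>(a, b).
     let c = (int (P1_M N C) * a - b) mod N; d = inv\<^bsub>residue_ring N\<^esub> c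
     in (a \<otimes>\<^bsub>residue_ring N\<^esub> d, b \<otimes>\<^bsub>residue_ring N\<^esub> d)) ` C)"

definition M_max :: "int \<Rightarrow> int \<Rightarrow> nat" where
  "M_max N j = Max {P1_M N C | C. C \<in> P1_H N \<and> fst (P1_pr N C) = j mod N}"

definition N1 :: "int \<Rightarrow> int" where "N1 N = (N - 1) div 2"

definition N2 :: "int \<Rightarrow> int" where "N2 N = N div 2"

definition tilde :: "int \<Rightarrow> int \<Rightarrow> int" where
  "tilde N x = (THE y. [y = x] (mod N) \<and> - N1 N \<le> y \<and> y \<le> N2 N)"

definition Theta0 :: "int \<Rightarrow> (int^2^2) list" where
  "Theta0 N =
     [matS ** T_pow i. i \<leftarrow> [- N1 N..N2 N]] @
     [matS ** T_pow j ** matS ** T_pow (int m).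
        j \<leftarrow> [- N1 N..N2 N], gcd j N > 1, m \<leftarrow> [0..<Suc (M_max N j)]]"

text \<open>The argument \<open>kinv\<close> provides the chosen integer inverses modulo \<open>N\<close>.\<close>

definition Theta1 :: "int \<Rightarrow> (int \<Rightarrow> int) \<Rightarrow> (int^2^2) list" where
  "Theta1 N kinv =
     [matS ** T_pow i. i \<leftarrow> [- N1 N..N2 N]] @
     [matS ** T_pow j ** matS ** T_pow (int m).
        j \<leftarrow> [- N1 N..N2 N], gcd j N > 1, m \<leftarrow> [0..<Suc (M_max N j)]] @
     [matS ** T_pow k ** matS ** T_pow i.
        k \<leftarrow> [- N1 N..-2], gcd k N = 1, i \<leftarrow> [- N1 N..N2 N]] @
     [matS ** T_pow k ** matS ** T_pow (tilde N (kinv k + j)) ** matS ** T_pow (int m).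
        k \<leftarrow> [- N1 N..-2], gcd k N = 1,
        j \<leftarrow> [- N1 N..N2 N], gcd j N > 1, m \<leftarrow> [0..<Suc (M_max N j)]]"

definition ThetaN :: "int \<Rightarrow> (int \<Rightarrow> int) \<Rightarrow> (int^2^2) list" where
  "ThetaN N kinv = [T_pow l ** \<gamma>. l \<leftarrow> [- N1 N..N2 N], \<gamma> \<leftarrow> Theta1 N kinv]"

end

theory Submission
  imports Defs
begin

text \<open>
  The coset of a matrix is determined by its bottom row modulo \<open>N\<close>: up to units for \<open>\<Gamma>\<^sub>0(N)\<close>,
  up to sign for \<open>\<plusminus>\<Gamma>\<^sub>1(N)\<close>. The matrices \<open>S T\<^sup>i\<close> and \<open>S T\<^sup>j S T\<^sup>m\<close> have bottom rows \<open>(1, i)\<close> and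
  \<open>(j, j m - 1)\<close>. A class \<open>(a : b)\<close> with \<open>a\<close> not a unit is multiplied by the inverse of
  \<open>c = M(a : b) a - b\<close>, which gives \<open>(j, j m - 1)\<close> with \<open>m = M(a : b)\<close>, and \<open>m \<le> M\<^sub>j\<close> means that no
  \<open>1 \<le> t \<le> m\<close> makes \<open>t j - 1\<close> a unit; this yields a bijection with \<open>P\<^sup>1(\<int>/N\<int>)\<close>. The further
  elements for \<open>\<Gamma>\<^sub>1(N)\<close> multiply these rows by representatives \<open>k\<close> of the units modulo sign, and
  left multiplication by \<open>T\<^sup>\<ell>\<close> lifts from \<open>\<Gamma>\<^sub>1(N)\<close> to \<open>\<Gamma>(N)\<close>.

  For connectedness, the tiles of \<open>A\<close> and \<open>A T\<close>, and those of \<open>A\<close> and \<open>A S\<close>, share an edge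
  whose interior points are interior to the union of the two closed tiles. Each list is
  connected along such edges; the translates by \<open>T\<^sup>\<ell>\<close> meet in the tiles of \<open>S\<^sup>2 = -I\<close>.
\<close>

section \<open>Cosets of the congruence subgroups\<close>

definition mat2 :: "int \<Rightarrow> int \<Rightarrow> int \<Rightarrow> int \<Rightarrow> int^2^2" where
  "mat2 a b c d = vector [vector [a, b], vector [c, d]]"

text \<open>The adjugate. For determinant 1 it is the inverse, with entries linear in those of
  \<open>A\<close>, so that coset tests become congruences between entries.\<close>

definition adj2 :: "int^2^2 \<Rightarrow> int^2^2" where
  "adj2 A = mat2 (A$2$2) (- A$1$2) (- A$2$1) (A$1$1)"

lemma mat2_nth [simp]:
  "mat2 a b c d $ 1 $ 1 = a" "mat2 a b c d $ 1 $ 2 = b"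
  "mat2 a b c d $ 2 $ 1 = c" "mat2 a b c d $ 2 $ 2 = d"
  by (simp_all add: mat2_def vector_def)

lemma mat2_eq_iff:
  "A = B \<longleftrightarrow> A$1$1 = B$1$1 \<and> A$1$2 = B$1$2 \<and> A$2$1 = B$2$1 \<and> A$2$2 = B$2$2"
  for A B :: "'a^2^2"
  by (auto simp: vec_eq_iff forall_2)

lemma mult_nth2: "(A ** B) $ i $ j = A$i$1 * B$1$j + A$i$2 * B$2$j"
  for A B :: "'a::semiring_1^2^2"
  by (simp add: matrix_matrix_mult_def sum_2)

lemma one_nth2 [simp]:
  "(mat 1 :: int^2^2) $ 1 $ 1 = 1" "(mat 1 :: int^2^2) $ 1 $ 2 = 0"
  "(mat 1 :: int^2^2) $ 2 $ 1 = 0" "(mat 1 :: int^2^2) $ 2 $ 2 = 1"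
  by (simp_all add: mat_def)

lemma matS_eq: "matS = mat2 0 (-1) 1 0" and matT_eq: "matT = mat2 1 1 0 1"
  by (simp_all add: matS_def matT_def mat2_def)

lemma carrier_SL2Z: "A \<in> carrier SL2Z \<longleftrightarrow> A$1$1 * A$2$2 - A$1$2 * A$2$1 = 1"
  by (simp add: SL2Z_def det_2)

lemma SL2Z_simps [simp]: "mult SL2Z = (**)" "one SL2Z = mat 1"
  by (simp_all add: SL2Z_def)

lemma adj2_closed [simp]: "A \<in> carrier SL2Z \<Longrightarrow> adj2 A \<in> carrier SL2Z"
  by (simp add: carrier_SL2Z adj2_def algebra_simps)

lemma adj2_inverse [simp]:
  assumes "A \<in> carrier SL2Z"
  shows "adj2 A ** A = mat 1" "A ** adj2 A = mat 1"
  using assms by (simp_all add: carrier_SL2Z adj2_def mat2_eq_iff mult_nth2 algebra_simps)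

lemma mult_closed_SL2Z [simp]:
  "A \<in> carrier SL2Z \<Longrightarrow> B \<in> carrier SL2Z \<Longrightarrow> A ** B \<in> carrier SL2Z"
  by (simp add: SL2Z_def det_mul)

lemma one_closed_SL2Z [simp]: "mat 1 \<in> carrier SL2Z"
  by (simp add: carrier_SL2Z)

lemma uminus_closed_SL2Z [simp]: "- A \<in> carrier SL2Z \<longleftrightarrow> A \<in> carrier SL2Z"
  by (simp add: carrier_SL2Z)

lemma group_SL2Z: "group SL2Z"
proof (rule groupI)
  fix A assume "A \<in> carrier SL2Z"
  then show "\<exists>B\<in>carrier SL2Z. B \<otimes>\<^bsub>SL2Z\<^esub> A = \<one>\<^bsub>SL2Z\<^esub>"
    by (intro bexI[of _ "adj2 A"]) auto
qed (auto simp: matrix_mul_assoc)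

interpretation SL2Z: group SL2Z
  by (rule group_SL2Z)

lemma inv_SL2Z: "A \<in> carrier SL2Z \<Longrightarrow> inv\<^bsub>SL2Z\<^esub> A = adj2 A"
  by (rule SL2Z.inv_equality) auto

lemma matS_closed [simp]: "matS \<in> carrier SL2Z" and matT_closed [simp]: "matT \<in> carrier SL2Z"
  by (simp_all add: carrier_SL2Z matS_eq matT_eq)

lemma T_pow_add: "T_pow (i + j) = T_pow i ** T_pow j"
  using SL2Z.int_pow_mult[OF matT_closed] by simp

lemma T_pow_1: "T_pow 1 = matT"
  using SL2Z.int_pow_1[OF matT_closed] by simp

lemma T_pow_0: "T_pow 0 = mat 1"
  by (simp add: int_pow_0)

lemma T_pow_eq: "T_pow i = mat2 1 i 0 1"
proof (induction i rule: int_induct[of _ 0])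
  case base
  show ?case by (simp add: T_pow_0 mat2_eq_iff)
next
  case (step1 i)
  then show ?case
    using T_pow_add[of i 1] T_pow_1 by (simp add: mat2_eq_iff mult_nth2 matT_eq)
next
  case (step2 i)
  have "T_pow (-1) = adj2 matT"
    using SL2Z.int_pow_neg[OF matT_closed, of 1] T_pow_1 by (simp add: inv_SL2Z)
  then show ?case
    using step2 T_pow_add[of i "-1"] by (simp add: mat2_eq_iff mult_nth2 matT_eq adj2_def)
qed

lemma T_pow_closed [simp]: "T_pow i \<in> carrier SL2Z"
  by (simp add: T_pow_eq carrier_SL2Z)

lemma uminus_mult_2 [simp]: "(- A) ** B = - (A ** B)" "A ** (- B) = - (A ** B)"
  for A B :: "int^2^2"
  by (simp_all add: mat2_eq_iff mult_nth2)

section \<open>Adjoining the sign, and tests for equality of right cosets\<close>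

lemma pm_I_eq: "pm_I \<Gamma> = \<Gamma> \<union> uminus ` \<Gamma>"
  by (auto simp: pm_I_def set_mult_def)

lemma subgroup_pm_I:
  assumes "subgroup \<Gamma> SL2Z"
  shows "subgroup (pm_I \<Gamma>) SL2Z"
proof (rule SL2Z.subgroupI)
  have sub: "A \<in> carrier SL2Z" if "A \<in> \<Gamma>" for A
    using that assms subgroup.subset by blast
  have closed: "A ** B \<in> \<Gamma>" if "A \<in> \<Gamma>" "B \<in> \<Gamma>" for A B
    using subgroup.m_closed[OF assms that] by simp
  have inverse: "adj2 A \<in> \<Gamma>" if "A \<in> \<Gamma>" for A
    using subgroup.m_inv_closed[OF assms that] sub[OF that] by (simp add: inv_SL2Z)
  have adj2_uminus: "adj2 (- A) = - adj2 A" for A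
    by (simp add: adj2_def mat2_eq_iff)
  show "pm_I \<Gamma> \<subseteq> carrier SL2Z"
    using sub by (auto simp: pm_I_eq)
  show "pm_I \<Gamma> \<noteq> {}"
    using subgroup.one_closed[OF assms] by (auto simp: pm_I_eq)
  show "inv\<^bsub>SL2Z\<^esub> A \<in> pm_I \<Gamma>" if "A \<in> pm_I \<Gamma>" for A
    using that sub inverse by (auto simp: pm_I_eq inv_SL2Z adj2_uminus)
  show "A \<otimes>\<^bsub>SL2Z\<^esub> B \<in> pm_I \<Gamma>" if "A \<in> pm_I \<Gamma>" "B \<in> pm_I \<Gamma>" for A B
    using that closed by (auto simp: pm_I_eq image_iff)
qed

lemma rcoset_eq_iff:
  assumes "subgroup H SL2Z" "A \<in> carrier SL2Z" "B \<in> carrier SL2Z"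
  shows "H #>\<^bsub>SL2Z\<^esub> A = H #>\<^bsub>SL2Z\<^esub> B \<longleftrightarrow> A ** adj2 B \<in> H"
proof -
  have "H #>\<^bsub>SL2Z\<^esub> A = H #>\<^bsub>SL2Z\<^esub> B \<longleftrightarrow> A \<in> H #>\<^bsub>SL2Z\<^esub> B"
    using assms SL2Z.repr_independence SL2Z.repr_independenceD by metis
  also have "\<dots> \<longleftrightarrow> A ** adj2 B \<in> H"
    using subgroup.rcos_module[OF assms(1) group_SL2Z assms(3,2)] assms(3) by (simp add: inv_SL2Z)
  finally show ?thesis .
qed

text \<open>\<open>adj2\<close> is the inverse on \<open>SL\<^sub>2(\<int>)\<close>, so \<open>A\<close> and \<open>B\<close> have the same right coset iff
  \<open>A ** adj2 B\<close> is in the subgroup.\<close>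

lemma mult_adj2_nth:
  "(A ** adj2 B)$1$1 = A$1$1 * B$2$2 - A$1$2 * B$2$1"
  "(A ** adj2 B)$1$2 = A$1$2 * B$1$1 - A$1$1 * B$1$2"
  "(A ** adj2 B)$2$1 = A$2$1 * B$2$2 - A$2$2 * B$2$1"
  "(A ** adj2 B)$2$2 = A$2$2 * B$1$1 - A$2$1 * B$1$2"
  for A B :: "int^2^2"
  by (simp_all add: mult_nth2 adj2_def)

text \<open>The lower left entry of \<open>A ** adj2 B\<close> is the determinant of the two bottom
  rows; its vanishing modulo \<open>N\<close> says that they give the same point of the projective
  line.\<close>

lemma Gamma0_mult_adj2:
  assumes "A \<in> carrier SL2Z" "B \<in> carrier SL2Z"
  shows "A ** adj2 B \<in> Gamma0 N \<longleftrightarrow> [A$2$1 * B$2$2 = A$2$2 * B$2$1] (mod N)"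
  using assms by (simp add: Gamma0_def mult_adj2_nth cong_iff_dvd_diff)

text \<open>Forward: the bottom row of \<open>A\<close> is the bottom row of the product, (0, 1)
  modulo \<open>N\<close>, multiplied by \<open>B\<close>. Backward: exchanging congruent bottom
  rows turns the diagonal entries into the determinants of \<open>A\<close> and \<open>B\<close>,
  and the lower left entry into 0.\<close>

lemma Gamma1_mult_adj2:
  assumes A: "A \<in> carrier SL2Z" and B: "B \<in> carrier SL2Z"
  shows "A ** adj2 B \<in> Gamma1 N \<longleftrightarrow> [A$2$1 = B$2$1] (mod N) \<and> [A$2$2 = B$2$2] (mod N)"
proof
  assume "A ** adj2 B \<in> Gamma1 N"
  then have r: "[A$2$1 * B$2$2 - A$2$2 * B$2$1 = 0] (mod N)"
      "[A$2$2 * B$1$1 - A$2$1 * B$1$2 = 1] (mod N)"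
    by (simp_all add: Gamma1_def mult_adj2_nth)
  have B': "B$1$1 * B$2$2 = 1 + B$1$2 * B$2$1"
    using B by (simp add: carrier_SL2Z)
  have "A$2$1 = B$1$1 * (A$2$1 * B$2$2 - A$2$2 * B$2$1)
      + B$2$1 * (A$2$2 * B$1$1 - A$2$1 * B$1$2)"
    using arg_cong[OF B', of "\<lambda>x. A$2$1 * x"] by (simp add: algebra_simps)
  moreover have "[B$1$1 * (A$2$1 * B$2$2 - A$2$2 * B$2$1)
      + B$2$1 * (A$2$2 * B$1$1 - A$2$1 * B$1$2) = B$1$1 * 0 + B$2$1 * 1] (mod N)"
    by (intro cong_add cong_mult r cong_refl)
  ultimately have 1: "[A$2$1 = B$2$1] (mod N)"
    by simp
  have "A$2$2 = B$1$2 * (A$2$1 * B$2$2 - A$2$2 * B$2$1)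
      + B$2$2 * (A$2$2 * B$1$1 - A$2$1 * B$1$2)"
    using arg_cong[OF B', of "\<lambda>x. A$2$2 * x"] by (simp add: algebra_simps)
  moreover have "[B$1$2 * (A$2$1 * B$2$2 - A$2$2 * B$2$1)
      + B$2$2 * (A$2$2 * B$1$1 - A$2$1 * B$1$2) = B$1$2 * 0 + B$2$2 * 1] (mod N)"
    by (intro cong_add cong_mult r cong_refl)
  ultimately show "[A$2$1 = B$2$1] (mod N) \<and> [A$2$2 = B$2$2] (mod N)"
    using 1 by simp
next
  assume r: "[A$2$1 = B$2$1] (mod N) \<and> [A$2$2 = B$2$2] (mod N)"
  have "[A$1$1 * B$2$2 - A$1$2 * B$2$1 = A$1$1 * A$2$2 - A$1$2 * A$2$1] (mod N)"
    using r by (intro cong_diff cong_mult cong_refl) (auto intro: cong_sym)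
  moreover have "[A$2$1 * B$2$2 - A$2$2 * B$2$1 = B$2$1 * B$2$2 - B$2$2 * B$2$1] (mod N)"
    using r by (intro cong_diff cong_mult cong_refl) auto
  moreover have "[A$2$2 * B$1$1 - A$2$1 * B$1$2 = B$2$2 * B$1$1 - B$2$1 * B$1$2] (mod N)"
    using r by (intro cong_diff cong_mult cong_refl) auto
  ultimately show "A ** adj2 B \<in> Gamma1 N"
    using A B by (simp add: Gamma1_def mult_adj2_nth) (simp add: carrier_SL2Z mult.commute)
qed

definition mat_cong :: "int \<Rightarrow> int^2^2 \<Rightarrow> int^2^2 \<Rightarrow> bool" where
  "mat_cong N A B \<longleftrightarrow> (\<forall>i j. [A$i$j = B$i$j] (mod N))"

lemma mat_cong_iff: "mat_cong N A B \<longleftrightarrow> [A$1$1 = B$1$1] (mod N) \<and> [A$1$2 = B$1$2] (mod N) \<and>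
    [A$2$1 = B$2$1] (mod N) \<and> [A$2$2 = B$2$2] (mod N)"
  by (auto simp: mat_cong_def forall_2)

lemma mat_cong_refl [simp]: "mat_cong N A A"
  by (simp add: mat_cong_def)

lemma mat_cong_mult: "mat_cong N A A' \<Longrightarrow> mat_cong N B B' \<Longrightarrow> mat_cong N (A ** B) (A' ** B')"
  unfolding mat_cong_def mult_nth2 by (auto intro!: cong_add cong_mult)

lemma GammaN_iff: "A \<in> GammaN N \<longleftrightarrow> A \<in> carrier SL2Z \<and> mat_cong N A (mat 1)"
  by (simp add: GammaN_def mat_cong_iff)

lemma GammaN_mult_adj2:
  assumes A: "A \<in> carrier SL2Z" and B: "B \<in> carrier SL2Z"
  shows "A ** adj2 B \<in> GammaN N \<longleftrightarrow> mat_cong N A B"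
proof
  assume "A ** adj2 B \<in> GammaN N"
  then have "mat_cong N ((A ** adj2 B) ** B) (mat 1 ** B)"
    by (intro mat_cong_mult) (auto simp: GammaN_iff)
  then show "mat_cong N A B"
    using B by (simp flip: matrix_mul_assoc)
next
  assume "mat_cong N A B"
  then have "mat_cong N (A ** adj2 B) (B ** adj2 B)"
    by (intro mat_cong_mult) auto
  then show "A ** adj2 B \<in> GammaN N"
    using A B by (simp add: GammaN_iff)
qed

text \<open>One-step subgroup test, phrased with \<open>adj2\<close> so that the criteria above for
  \<open>A ** adj2 B\<close> also prove the subgroup property.\<close>

lemma subgroup_SL2Z_I:
  assumes "\<Gamma> \<subseteq> carrier SL2Z" "mat 1 \<in> \<Gamma>"
    and *: "\<And>A B. A \<in> \<Gamma> \<Longrightarrow> B \<in> \<Gamma> \<Longrightarrow> A ** adj2 B \<in> \<Gamma>"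
  shows "subgroup \<Gamma> SL2Z"
proof -
  have "adj2 A \<in> \<Gamma>" if "A \<in> \<Gamma>" for A
    using *[OF assms(2) that] by simp
  moreover have "adj2 (adj2 A) = A" for A
    by (simp add: adj2_def mat2_eq_iff)
  ultimately have "A ** B \<in> \<Gamma>" if "A \<in> \<Gamma>" "B \<in> \<Gamma>" for A B
    using *[of A "adj2 B"] that by simp
  with assms \<open>\<And>A. A \<in> \<Gamma> \<Longrightarrow> adj2 A \<in> \<Gamma>\<close> show ?thesis
    by (intro SL2Z.subgroupI) (auto simp: subset_iff inv_SL2Z)
qed

lemma subgroup_Gamma0: "subgroup (Gamma0 N) SL2Z"
proof (rule subgroup_SL2Z_I)
  fix A B assume AB: "A \<in> Gamma0 N" "B \<in> Gamma0 N"
  then have "[A$2$1 * B$2$2 = 0 * B$2$2] (mod N)" "[A$2$2 * B$2$1 = A$2$2 * 0] (mod N)"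
    by (intro cong_mult cong_refl; simp add: Gamma0_def)+
  with AB show "A ** adj2 B \<in> Gamma0 N"
    by (subst Gamma0_mult_adj2) (auto simp: Gamma0_def intro: cong_trans cong_sym)
qed (auto simp: Gamma0_def)

lemma subgroup_Gamma1: "subgroup (Gamma1 N) SL2Z"
proof (rule subgroup_SL2Z_I)
  fix A B assume "A \<in> Gamma1 N" "B \<in> Gamma1 N"
  then show "A ** adj2 B \<in> Gamma1 N"
    by (subst Gamma1_mult_adj2) (auto simp: Gamma1_def intro: cong_trans cong_sym)
qed (auto simp: Gamma1_def)

lemma subgroup_GammaN: "subgroup (GammaN N) SL2Z"
proof (rule subgroup_SL2Z_I)
  fix A B assume "A \<in> GammaN N" "B \<in> GammaN N"
  then show "A ** adj2 B \<in> GammaN N"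
    by (subst GammaN_mult_adj2) (auto simp: GammaN_iff mat_cong_iff intro: cong_trans cong_sym)
qed (auto simp: GammaN_def)

text \<open>A right coset of a group containing \<open>\<Gamma>(N)\<close> only depends on the entries modulo \<open>N\<close>.\<close>

lemma finite_rcosets_SL2Z:
  assumes "subgroup \<Gamma> SL2Z" "GammaN N \<subseteq> \<Gamma>" "N > 0"
  shows "finite (rcosets\<^bsub>SL2Z\<^esub> \<Gamma>)"
proof -
  define red :: "int^2^2 \<Rightarrow> int \<times> int \<times> int \<times> int" where
    "red = (\<lambda>A. (A$1$1 mod N, A$1$2 mod N, A$2$1 mod N, A$2$2 mod N))"
  have *: "\<Gamma> #>\<^bsub>SL2Z\<^esub> A = \<Gamma> #>\<^bsub>SL2Z\<^esub> B"
    if "A \<in> carrier SL2Z" "B \<in> carrier SL2Z" "red A = red B" for A B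
  proof -
    have "mat_cong N A B"
      using that by (simp add: red_def mat_cong_iff cong_def)
    then have "A ** adj2 B \<in> \<Gamma>"
      using that(1,2) assms(2) GammaN_mult_adj2 by blast
    then show ?thesis
      by (simp add: rcoset_eq_iff[OF assms(1) that(1,2)])
  qed
  define rep where "rep r = (SOME A. A \<in> carrier SL2Z \<and> red A = r)" for r
  have rep: "rep (red A) \<in> carrier SL2Z \<and> red (rep (red A)) = red A" if "A \<in> carrier SL2Z" for A
    unfolding rep_def by (rule someI[of _ A]) (use that in simp)
  have "rcosets\<^bsub>SL2Z\<^esub> \<Gamma> \<subseteq> (\<lambda>r. \<Gamma> #>\<^bsub>SL2Z\<^esub> rep r) ` red ` carrier SL2Z"
  proof
    fix C assume "C \<in> rcosets\<^bsub>SL2Z\<^esub> \<Gamma>"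
    then obtain A where A: "A \<in> carrier SL2Z" and C: "C = \<Gamma> #>\<^bsub>SL2Z\<^esub> A"
      unfolding RCOSETS_def by blast
    have "C = \<Gamma> #>\<^bsub>SL2Z\<^esub> rep (red A)"
      unfolding C using rep[OF A] A by (intro *) simp_all
    then show "C \<in> (\<lambda>r. \<Gamma> #>\<^bsub>SL2Z\<^esub> rep r) ` red ` carrier SL2Z"
      using A by (intro image_eqI[of _ _ "red A"] imageI) simp_all
  qed
  moreover have "red ` carrier SL2Z \<subseteq> {0..<N} \<times> {0..<N} \<times> {0..<N} \<times> {0..<N}"
    using assms(3) by (auto simp: red_def)
  then have "finite (red ` carrier SL2Z)"
    by (rule finite_subset) simp
  ultimately show ?thesis
    using finite_surj[of "red ` carrier SL2Z"] by simp
qed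

section \<open>The numbers \<open>M\<^sub>j\<close> and the projective line modulo \<open>N\<close>\<close>

lemma not_coprime_int_primeE:
  fixes x N :: int
  assumes "N > 0" "\<not> coprime x N"
  obtains p where "prime p" "p dvd x" "p dvd N"
proof -
  have "gcd x N \<noteq> 0" "\<not> is_unit (gcd x N)"
    using assms by (auto simp: is_unit_gcd)
  then obtain p where "p dvd gcd x N" "prime p"
    using prime_divisor_exists by blast
  with that show ?thesis
    by auto
qed

text \<open>The shift is the product \<open>q\<close> of the primes of \<open>N\<close> that do not
  divide \<open>b\<close>. A prime of \<open>N\<close> divides exactly one of \<open>q\<close> and
  \<open>b\<close>; if it divides \<open>b\<close>, it does not divide \<open>a\<close>. So it
  always divides exactly one of \<open>q * a\<close> and \<open>b\<close>.\<close>

lemma exists_coprime_shift: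
  fixes a b N :: int
  assumes "N > 0" "gcd a (gcd b N) = 1"
  shows "\<exists>m::nat. coprime (int m * a - b) N"
proof -
  define q where "q = \<Prod>{p \<in> prime_factors N. \<not> p dvd b}"
  have q: "p dvd q \<longleftrightarrow> \<not> p dvd b" if p: "prime p" "p dvd N" for p
  proof -
    have "p dvd q \<longleftrightarrow> (\<exists>r \<in> {p \<in> prime_factors N. \<not> p dvd b}. p dvd r)"
      unfolding q_def using p by (intro prime_dvd_prod_iff) auto
    also have "\<dots> \<longleftrightarrow> \<not> p dvd b"
      using p \<open>N > 0\<close> by (auto simp: prime_factors_dvd dest: primes_dvd_imp_eq)
    finally show ?thesis .
  qed
  have "q \<ge> 0"
    unfolding q_def by (intro prod_nonneg) (auto simp: prime_factors_dvd prime_ge_0_int)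
  have "coprime (q * a - b) N"
  proof (rule ccontr)
    assume "\<not> coprime (q * a - b) N"
    then obtain p where p: "prime p" "p dvd q * a - b" "p dvd N"
      by (rule not_coprime_int_primeE[OF \<open>N > 0\<close>])
    show False
    proof (cases "p dvd b")
      case True
      then have "p dvd q * a"
        using p(2) by (metis dvd_add diff_add_cancel)
      with True q[OF p(1,3)] p(1) have "p dvd a"
        by (simp add: prime_dvd_mult_iff)
      with True p(3) have "p dvd 1"
        using assms(2) by (metis gcd_greatest)
      with p(1) show False
        by (simp add: not_prime_unit)
    next
      case False
      with q[OF p(1,3)] have "p dvd q * a"
        by simp
      with p(2) have "p dvd b"
        by (metis dvd_diff_commute dvd_diff_right_iff)
      with False show False ..
    qed
  qed
  with \<open>q \<ge> 0\<close> show ?thesis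
    by (metis int_nat_eq)
qed

lemma coprime_cong_int: "[x = y] (mod N) \<Longrightarrow> coprime x N \<longleftrightarrow> coprime y N"
  for x y N :: int
  by (metis cong_gcd_eq coprime_iff_gcd_eq_1)

lemma coprime_mult_cong_left:
  fixes x y u N :: int
  assumes "coprime u N" "[x = u * y] (mod N)"
  shows "coprime x N \<longleftrightarrow> coprime y N"
  using assms coprime_cong_int[OF assms(2)] by simp

text \<open>M(a : b) computed on a representative, for arbitrary integers, so that no reduction
  modulo \<open>N\<close> intervenes.\<close>

definition first_shift :: "int \<Rightarrow> int \<Rightarrow> int \<Rightarrow> nat" where
  "first_shift N a b = (LEAST m. gcd (int m * a - b) N = 1)"

lemma first_shift_coprime:
  assumes "N > 0" "gcd a (gcd b N) = 1"
  shows "coprime (int (first_shift N a b) * a - b) N"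
  using exists_coprime_shift[OF assms] unfolding first_shift_def coprime_iff_gcd_eq_1
  by (rule LeastI_ex)

lemma first_shift_least:
  "m < first_shift N a b \<Longrightarrow> \<not> coprime (int m * a - b) N"
  unfolding first_shift_def coprime_iff_gcd_eq_1 by (rule not_less_Least)

text \<open>Scaling the pair by a unit multiplies every shift m a - b by it; hence M is well defined
  on classes.\<close>

lemma first_shift_cong_unit:
  assumes "coprime u N" "[a' = u * a] (mod N)" "[b' = u * b] (mod N)"
  shows "first_shift N a' b' = first_shift N a b"
proof -
  have "coprime (int m * a' - b') N \<longleftrightarrow> coprime (int m * a - b) N" for m
  proof (rule coprime_mult_cong_left[OF assms(1)])
    have "[int m * a' - b' = int m * (u * a) - u * b] (mod N)"
      by (intro cong_diff cong_mult cong_refl assms)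
    then show "[int m * a' - b' = u * (int m * a - b)] (mod N)"
      by (simp add: algebra_simps)
  qed
  then show ?thesis
    by (simp add: first_shift_def coprime_iff_gcd_eq_1)
qed

section \<open>Evaluation of \<open>P1_M\<close> and \<open>P1_pr\<close> on classes, and the set
  behind M_j\<close>

lemma P1_pairs_iff: "(a, b) \<in> P1_pairs N \<longleftrightarrow>
    0 \<le> a \<and> a < N \<and> 0 \<le> b \<and> b < N \<and> gcd a (gcd b N) = 1"
  by (auto simp: P1_pairs_def residue_ring_def)

context
  fixes N :: int
  assumes N: "N > 1"
begin

interpretation residues N "residue_ring N"
  using N by unfold_locales auto

lemma P1_rel_cong:
  assumes "((a, b), (a', b')) \<in> P1_rel N"
  obtains u where "coprime u N" "[a' = u * a] (mod N)" "[b' = u * b] (mod N)"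
  using assms by (auto simp: P1_rel_def res_units_eq res_mult_eq cong_def)

lemma P1_rel_refl: "p \<in> P1_pairs N \<Longrightarrow> (p, p) \<in> P1_rel N"
  using N by (auto simp: P1_rel_def P1_pairs_iff res_units_eq res_mult_eq intro!: exI[of _ 1])

lemma P1_M_class:
  assumes ab: "(a, b) \<in> P1_pairs N"
  shows "P1_M N (P1_rel N `` {(a, b)}) = first_shift N a b"
proof -
  have "the_elem ((\<lambda>(a, b). first_shift N a b) ` (P1_rel N `` {(a, b)})) = (\<lambda>(a, b). first_shift N a b) (a, b)"
  proof (rule the_elem_image_unique)
    show "P1_rel N `` {(a, b)} \<noteq> {}"
      using P1_rel_refl[OF ab] by blast
    show "(\<lambda>(a, b). first_shift N a b) p = (\<lambda>(a, b). first_shift N a b) (a, b)"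
      if "p \<in> P1_rel N `` {(a, b)}" for p
      using that by (cases p) (auto elim!: P1_rel_cong intro: first_shift_cong_unit)
  qed
  then show ?thesis
    by (simp add: P1_M_def first_shift_def)
qed

lemma residue_divide_eq:
  assumes "coprime c N" "0 \<le> y" "y < N" "[y * c = x] (mod N)" "0 \<le> x" "x < N"
  shows "x \<otimes>\<^bsub>residue_ring N\<^esub> inv\<^bsub>residue_ring N\<^esub> (c mod N) = y"
proof -
  have c: "c mod N \<in> Units (residue_ring N)"
    using assms(1) N by simp
  have "y \<otimes>\<^bsub>residue_ring N\<^esub> (c mod N) = x"
    using assms(4-6) by (simp add: res_mult_eq cong_def mod_mult_right_eq)
  moreover have "y \<in> carrier (residue_ring N)"
    using assms by (simp add: res_carrier_eq)
  ultimately show ?thesis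
    using c by (metis Units_closed Units_inv_closed Units_r_inv m_assoc r_one)
qed

text \<open>Scaling the pair by a unit scales c by the same unit, which cancels in both quotients,
  so \<open>the_elem\<close> is applied to a singleton. The quotients \<open>j\<close> = a/c and
  \<open>k\<close> = b/c are described by congruences to avoid inverses in the ring.\<close>

lemma P1_pr_class:
  assumes ab: "(a, b) \<in> P1_pairs N"
    and c: "c = int (first_shift N a b) * a - b"
    and j: "0 \<le> j" "j < N" "[j * c = a] (mod N)"
    and k: "0 \<le> k" "k < N" "[k * c = b] (mod N)"
  shows "P1_pr N (P1_rel N `` {(a, b)}) = (j, k)"
proof -
  define m where "m = first_shift N a b"
  define f where "f = (\<lambda>(a, b).
     let c = (int m * a - b) mod N; d = inv\<^bsub>residue_ring N\<^esub> c
     in (a \<otimes>\<^bsub>residue_ring N\<^esub> d, b \<otimes>\<^bsub>residue_ring N\<^esub> d))"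
  have cop: "coprime c N"
    using first_shift_coprime[of N a b] ab N by (simp add: c P1_pairs_iff)
  have f: "f p = (j, k)" if "p \<in> P1_rel N `` {(a, b)}" for p
  proof -
    obtain a' b' where p: "p = (a', b')"
      by (cases p)
    with that have rel: "((a, b), (a', b')) \<in> P1_rel N"
      by simp
    then have "(a', b') \<in> P1_pairs N"
      by (auto simp: P1_rel_def)
    then have range: "0 \<le> a'" "a' < N" "0 \<le> b'" "b' < N"
      by (auto simp: P1_pairs_iff)
    obtain u where u: "coprime u N" "[a' = u * a] (mod N)" "[b' = u * b] (mod N)"
      using rel by (rule P1_rel_cong)
    have "[int m * a' - b' = int m * (u * a) - u * b] (mod N)"
      by (intro cong_diff cong_mult cong_refl u)
    then have c': "[int m * a' - b' = u * c] (mod N)"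
      by (simp add: c m_def algebra_simps)
    then have cop': "coprime (int m * a' - b') N"
      using coprime_mult_cong_left[OF u(1) c'] cop by simp
    have *: "[y * (int m * a' - b') = x'] (mod N)" if "[y * c = x] (mod N)" "[x' = u * x] (mod N)" for x y x'
    proof -
      have "[y * (int m * a' - b') = y * (u * c)] (mod N)"
        by (intro cong_mult cong_refl c')
      also have "y * (u * c) = u * (y * c)"
        by simp
      also have "[u * (y * c) = u * x] (mod N)"
        by (intro cong_mult cong_refl that)
      finally show ?thesis
        using that(2) cong_sym cong_trans by blast
    qed
    show ?thesis
      unfolding p f_def Let_def prod.case
      using residue_divide_eq[OF cop' j(1,2) *[OF j(3) u(2)] range(1,2)]
        residue_divide_eq[OF cop' k(1,2) *[OF k(3) u(3)] range(3,4)] by simp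
  qed
  have ab': "(a, b) \<in> P1_rel N `` {(a, b)}"
    using P1_rel_refl[OF ab] by simp
  have "P1_pr N (P1_rel N `` {(a, b)}) = the_elem (f ` (P1_rel N `` {(a, b)}))"
    by (simp add: P1_pr_def f_def m_def P1_M_class[OF ab])
  also have "\<dots> = f (a, b)"
  proof (rule the_elem_image_unique)
    show "P1_rel N `` {(a, b)} \<noteq> {}"
      using ab' by blast
  qed (use f ab' in simp)
  also have "\<dots> = (j, k)"
    using f ab' .
  finally show ?thesis .
qed

text \<open>With j = a/c and c = m a - b one has (m - t) a - b = c (1 - t j) modulo
  \<open>N\<close>, so minimality of \<open>m\<close> says that no t from 1 to m makes t j - 1 a
  unit. The value t = 0 is left out because it stands for \<open>m\<close> itself.\<close>

lemma M_max_set: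
  assumes "gcd j N > 1"
  shows "{P1_M N C | C. C \<in> P1_H N \<and> fst (P1_pr N C) = j mod N}
    = {m. \<forall>t. 1 \<le> t \<and> t \<le> m \<longrightarrow> \<not> coprime (int t * j - 1) N}"
    (is "?S = {m. ?P m}")
proof (intro subset_antisym subsetI)
  fix m assume "m \<in> ?S"
  then obtain C where C: "C \<in> P1_H N" "fst (P1_pr N C) = j mod N" "m = P1_M N C"
    by blast
  then have "C \<in> P1_pairs N // P1_rel N"
    by (simp add: P1_H_def P1_def)
  then obtain a b where ab: "(a, b) \<in> P1_pairs N" and C_eq: "C = P1_rel N `` {(a, b)}"
    by (auto elim: quotientE)
  have m: "m = first_shift N a b"
    using C(3) P1_M_class[OF ab] by (simp add: C_eq)
  define c where "c = int m * a - b"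
  have cop: "coprime c N"
    using first_shift_coprime[of N a b] ab N by (simp add: c_def m P1_pairs_iff)
  then obtain d where d: "[c * d = 1] (mod N)"
    by (auto simp: coprime_iff_invertible_int)
  have dc: "[x * d mod N * c = x] (mod N)" for x
  proof -
    have "[x * d mod N * c = x * d * c] (mod N)"
      by (intro cong_mult cong_refl cong_mod_leftI)
    also have "x * d * c = x * (c * d)"
      by simp
    also have "[x * (c * d) = x * 1] (mod N)"
      by (intro cong_mult cong_refl d)
    finally show ?thesis
      by simp
  qed
  have "P1_pr N C = (a * d mod N, b * d mod N)"
    unfolding C_eq using N dc by (intro P1_pr_class[OF ab, of c]) (auto simp: c_def m)
  with C(2) have "[j = a * d mod N] (mod N)"
    by (simp add: cong_def)
  then have "[j * c = a * d mod N * c] (mod N)"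
    by (intro cong_mult cong_refl)
  then have jc: "[j * c = a] (mod N)"
    using dc cong_trans by blast
  have "\<not> coprime (int t * j - 1) N" if t: "1 \<le> t" "t \<le> m" for t
  proof
    assume "coprime (int t * j - 1) N"
    then have "coprime (- (int t * j - 1)) N"
      by (simp only: coprime_minus_left_iff)
    moreover have "[int (m - t) * a - b = c * (- (int t * j - 1))] (mod N)"
    proof -
      have "c * (- (int t * j - 1)) = c - int t * (j * c)"
        by (simp add: algebra_simps)
      also have "[c - int t * (j * c) = c - int t * a] (mod N)"
        by (intro cong_diff cong_mult cong_refl jc)
      also have "c - int t * a = int (m - t) * a - b"
        using t by (simp add: c_def of_nat_diff algebra_simps)
      finally show ?thesis
        by (rule cong_sym)
    qed
    ultimately have "coprime (int (m - t) * a - b) N"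
      using coprime_mult_cong_left[OF cop] by blast
    moreover have "m - t < first_shift N a b"
      using t m by simp
    ultimately show False
      using first_shift_least by blast
  qed
  then show "m \<in> {m. ?P m}"
    by blast
next
  fix m assume "m \<in> {m. ?P m}"
  then have P: "?P m"
    by simp
  \<comment> \<open>The class of (j, m j - 1) attains \<open>m\<close>: here c = 1 modulo
    \<open>N\<close>, so pr fixes the pair.\<close>
  define a b where "a = j mod N" and "b = (int m * j - 1) mod N"
  have shift: "[int m' * a - b = 1 - (int m - int m') * j] (mod N)" for m'
  proof -
    have "[int m' * a - b = int m' * j - (int m * j - 1)] (mod N)"
      unfolding a_def b_def by (intro cong_diff cong_mult cong_refl cong_mod_leftI)
    then show ?thesis
      by (simp add: algebra_simps)
  qed
  have one: "[int m * a - b = 1] (mod N)"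
    using shift[of m] by simp
  have "gcd a (gcd b N) = 1"
  proof -
    let ?g = "gcd a (gcd b N)"
    have "?g dvd a" "?g dvd b" "?g dvd N"
      by (auto intro: dvd_trans[OF gcd_dvd2])
    then have "?g dvd int m * a - b" "?g dvd N"
      by auto
    then have "?g dvd 1"
      using one by (metis cong_dvd_iff cong_dvd_modulus)
    then show ?thesis
      by simp
  qed
  then have ab: "(a, b) \<in> P1_pairs N"
    using N by (simp add: P1_pairs_iff a_def b_def)
  let ?C = "P1_rel N `` {(a, b)}"
  have first: "first_shift N a b = m"
    unfolding first_shift_def
  proof (rule Least_equality)
    show "gcd (int m * a - b) N = 1"
      using coprime_cong_int[OF one] by (simp add: coprime_iff_gcd_eq_1)
    fix m' assume "gcd (int m' * a - b) N = 1"
    then have cop: "coprime (1 - (int m - int m') * j) N"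
      using coprime_cong_int[OF shift] by (simp add: coprime_iff_gcd_eq_1)
    show "m \<le> m'"
    proof (rule ccontr)
      assume "\<not> m \<le> m'"
      then have "int (m - m') = int m - int m'" "1 \<le> m - m'"
        by auto
      with cop have "coprime (- (int (m - m') * j - 1)) N"
        by simp
      then have "coprime (int (m - m') * j - 1) N"
        by (simp only: coprime_minus_left_iff)
      with P \<open>1 \<le> m - m'\<close> show False
        using diff_le_self by blast
    qed
  qed
  have "gcd a N > 1"
    using assms cong_gcd_eq[of "j mod N" j N] by (simp add: a_def)
  then have "?C \<in> P1_H N"
    using ab P1_rel_refl[OF ab] unfolding P1_H_def P1_def by (auto intro: quotientI)
  moreover have "P1_pr N ?C = (a, b)"
  proof -
    have "[x * (int (first_shift N a b) * a - b) = x] (mod N)" for x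
      using cong_mult[OF cong_refl one, of x] by (simp add: first)
    then show ?thesis
      using ab by (intro P1_pr_class[OF ab refl]) (auto simp: P1_pairs_iff)
  qed
  moreover have "P1_M N ?C = m"
    using P1_M_class[OF ab] first by simp
  ultimately show "m \<in> ?S"
    by (auto simp: a_def intro!: exI[of _ ?C])
qed

end

text \<open>This is the only property of \<open>M\<^sub>j\<close> that the list of representatives relies on.\<close>

lemma le_M_max_iff:
  assumes N: "N > 1" and j: "gcd j N > 1"
  shows "m \<le> M_max N j \<longleftrightarrow> (\<forall>t. 1 \<le> t \<and> t \<le> m \<longrightarrow> \<not> coprime (int t * j - 1) N)"
proof -
  define P where "P m \<longleftrightarrow> (\<forall>t. 1 \<le> t \<and> t \<le> m \<longrightarrow> \<not> coprime (int t * j - 1) N)" for m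
  have M: "M_max N j = Max {m. P m}"
    unfolding M_max_def M_max_set[OF N j] P_def ..
  \<comment> \<open>For m at least \<open>N\<close> the value t = \<open>N\<close> would be allowed,
    but N j - 1 is congruent to the unit -1. So the set is finite and \<open>Max\<close> is
    meaningful.\<close>
  have "m < nat N" if "P m" for m
  proof (rule ccontr)
    assume "\<not> m < nat N"
    with that N have "\<not> coprime (N * j - 1) N"
      by (auto simp: P_def dest!: spec[of _ "nat N"])
    moreover have "[N * j - 1 = -1] (mod N)"
      by (simp add: cong_iff_dvd_diff)
    then have "coprime (N * j - 1) N"
      using coprime_cong_int[of "N * j - 1" "-1" N] by simp
    ultimately show False ..
  qed
  then have fin: "finite {m. P m}"
    by (intro finite_subset[of "{m. P m}" "{..<nat N}"]) auto
  have "P 0"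
    by (simp add: P_def)
  then have "P (M_max N j)"
    using Max_in[OF fin] M by auto
  then have "P m" if "m \<le> M_max N j"
    using that by (auto simp: P_def)
  moreover have "m \<le> M_max N j" if "P m"
    using Max_ge[OF fin] that M by simp
  ultimately show ?thesis
    unfolding P_def by blast
qed

section \<open>Residues between \<open>- N1 N\<close> and \<open>N2 N\<close>, and normal forms of
  bottom rows\<close>

lemma N_range: "N1 N + N2 N = N - 1"
  unfolding N1_def N2_def by presburger

lemma exists_in_range:
  assumes "N > 1"
  shows "\<exists>y. [y = x] (mod N) \<and> - N1 N \<le> y \<and> y \<le> N2 N"
proof (intro exI conjI)
  let ?y = "(x + N1 N) mod N - N1 N"
  have "[?y = (x + N1 N) - N1 N] (mod N)"
    by (intro cong_diff cong_refl cong_mod_leftI)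
  then show "[?y = x] (mod N)"
    by simp
  show "- N1 N \<le> ?y" "?y \<le> N2 N"
    using pos_mod_sign[of N "x + N1 N"] pos_mod_bound[of N "x + N1 N"] N_range[of N] assms
    by linarith+
qed

lemma eq_in_range:
  assumes "N > 1" "[x = y] (mod N)" "- N1 N \<le> x" "x \<le> N2 N" "- N1 N \<le> y" "y \<le> N2 N"
  shows "x = y"
proof -
  have "N dvd x - y"
    using assms(2) by (simp add: cong_iff_dvd_diff)
  moreover have "\<bar>x - y\<bar> < N"
    using assms N_range[of N] by linarith
  ultimately show ?thesis
    using dvd_imp_le_int[of "x - y" N] assms(1) by fastforce
qed

lemma tilde_props:
  assumes "N > 1"
  shows "[tilde N x = x] (mod N)" "- N1 N \<le> tilde N x" "tilde N x \<le> N2 N"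
proof -
  have "\<exists>!y. [y = x] (mod N) \<and> - N1 N \<le> y \<and> y \<le> N2 N"
    using exists_in_range[OF assms, of x] eq_in_range[OF assms]
    by (metis cong_sym cong_trans)
  then have "[tilde N x = x] (mod N) \<and> - N1 N \<le> tilde N x \<and> tilde N x \<le> N2 N"
    unfolding tilde_def by (rule theI')
  then show "[tilde N x = x] (mod N)" "- N1 N \<le> tilde N x" "tilde N x \<le> N2 N"
    by auto
qed

text \<open>The pairs \<open>(j, None)\<close> and \<open>(j, Some m)\<close> index the matrices \<open>S T\<^sup>j\<close> and \<open>S T\<^sup>j S T\<^sup>m\<close>; the functions
  \<open>row1\<close> and \<open>row2\<close> give the bottom rows of these matrices.\<close>

fun row1 :: "int \<Rightarrow> nat option \<Rightarrow> int" where
  "row1 j None = 1"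
| "row1 j (Some m) = j"

fun row2 :: "int \<Rightarrow> nat option \<Rightarrow> int" where
  "row2 j None = j"
| "row2 j (Some m) = int m * j - 1"

fun valid :: "int \<Rightarrow> int \<Rightarrow> nat option \<Rightarrow> bool" where
  "valid N j None \<longleftrightarrow> - N1 N \<le> j \<and> j \<le> N2 N"
| "valid N j (Some m) \<longleftrightarrow> - N1 N \<le> j \<and> j \<le> N2 N \<and> gcd j N > 1 \<and> m \<le> M_max N j"

text \<open>If \<open>c\<close> is a unit, it is factored out and \<open>j\<close> = d/c. Otherwise
  \<open>u\<close> is the first unit of the form m c - d, and \<open>j\<close> = c/u gives (c, d) =
  u (j, m j - 1).\<close>

lemma rows_exist:
  assumes N: "N > 1" and cd: "gcd c (gcd d N) = 1"
  obtains u j r where "coprime u N" "valid N j r" "[c = u * row1 j r] (mod N)" "[d = u * row2 j r] (mod N)"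
proof (cases "coprime c N")
  case True
  then obtain e where e: "[c * e = 1] (mod N)"
    by (auto simp: coprime_iff_invertible_int)
  obtain j where j: "[j = e * d] (mod N)" "- N1 N \<le> j" "j \<le> N2 N"
    using exists_in_range[OF N] by blast
  have "[c * j = c * (e * d)] (mod N)"
    by (intro cong_mult cong_refl j)
  also have "c * (e * d) = c * e * d"
    by simp
  also have "[c * e * d = 1 * d] (mod N)"
    by (intro cong_mult cong_refl e)
  finally have "[d = c * j] (mod N)"
    by (simp add: cong_sym)
  then show ?thesis
    using True j by (intro that[of c j None]) auto
next
  case False
  define m where "m = first_shift N c d"
  define u where "u = int m * c - d"
  have u: "coprime u N"
    unfolding u_def m_def using N cd by (intro first_shift_coprime) auto
  then obtain e where e: "[u * e = 1] (mod N)"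
    by (auto simp: coprime_iff_invertible_int)
  obtain j where j: "[j = e * c] (mod N)" "- N1 N \<le> j" "j \<le> N2 N"
    using exists_in_range[OF N] by blast
  have "[u * j = u * (e * c)] (mod N)"
    by (intro cong_mult cong_refl j)
  also have "u * (e * c) = u * e * c"
    by simp
  also have "[u * e * c = 1 * c] (mod N)"
    by (intro cong_mult cong_refl e)
  finally have uj: "[u * j = c] (mod N)"
    by simp
  have "\<not> coprime j N"
    using False coprime_mult_cong_left[OF u cong_sym[OF uj]] by simp
  then have "gcd j N \<noteq> 1"
    by (simp add: coprime_iff_gcd_eq_1)
  moreover have "gcd j N > 0"
    using N by (simp add: gcd_pos_int)
  ultimately have gj: "gcd j N > 1"
    by linarith
  \<comment> \<open>Minimality of \<open>m\<close> gives the bound by M_j: (m - t) c - d is u (1 - t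
    j) modulo \<open>N\<close>, and it is no unit for t from 1 to m.\<close>
  have "\<not> coprime (int t * j - 1) N" if t: "1 \<le> t" "t \<le> m" for t
  proof
    assume "coprime (int t * j - 1) N"
    then have "coprime (- (int t * j - 1)) N"
      by (simp only: coprime_minus_left_iff)
    moreover have "[int (m - t) * c - d = u * (- (int t * j - 1))] (mod N)"
    proof -
      have "u * (- (int t * j - 1)) = u - int t * (u * j)"
        by (simp add: algebra_simps)
      also have "[u - int t * (u * j) = u - int t * c] (mod N)"
        by (intro cong_diff cong_mult cong_refl uj)
      also have "u - int t * c = int (m - t) * c - d"
        using t by (simp add: u_def of_nat_diff algebra_simps)
      finally show ?thesis
        by (rule cong_sym)
    qed
    ultimately have "coprime (int (m - t) * c - d) N"
      using coprime_mult_cong_left[OF u] by blast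
    moreover have "m - t < first_shift N c d"
      using t m_def by simp
    ultimately show False
      using first_shift_least by blast
  qed
  then have "valid N j (Some m)"
    using j gj le_M_max_iff[OF N gj] by auto
  moreover have "[d = u * row2 j (Some m)] (mod N)"
  proof -
    have "u * row2 j (Some m) = int m * (u * j) - u"
      by (simp add: algebra_simps)
    also have "[int m * (u * j) - u = int m * c - u] (mod N)"
      by (intro cong_diff cong_mult cong_refl uj)
    also have "int m * c - u = d"
      by (simp add: u_def)
    finally show ?thesis
      by (rule cong_sym)
  qed
  ultimately show ?thesis
    using u uj by (intro that[of u j "Some m"]) (auto intro: cong_sym)
qed

text \<open>If k < m, the bound m \<le> M_j yields a prime \<open>p\<close> of \<open>N\<close> that
  divides (m - k) j - 1. The congruence says that \<open>N\<close> divides i ((m - k) j - 1) + j, so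
  \<open>p\<close> divides \<open>j\<close> and hence 1.\<close>

lemma shift_unique:
  assumes N: "N > 1" and "valid N i (Some k)" "valid N j (Some m)"
    and eq: "[i * (int m * j - 1) = (int k * i - 1) * j] (mod N)"
  shows "\<not> k < m"
proof
  assume "k < m"
  then have "1 \<le> m - k" "m - k \<le> m"
    by auto
  moreover have "gcd j N > 1" "m \<le> M_max N j"
    using assms(3) by auto
  ultimately have "\<not> coprime (int (m - k) * j - 1) N"
    using le_M_max_iff[OF N, of j m] by blast
  then obtain p where p: "prime p" "p dvd int (m - k) * j - 1" "p dvd N"
    using not_coprime_int_primeE[of N] N by (metis less_trans zero_less_one)
  have "N dvd i * (int m * j - 1) - (int k * i - 1) * j"
    using eq by (simp add: cong_iff_dvd_diff)
  also have "i * (int m * j - 1) - (int k * i - 1) * j = i * (int (m - k) * j - 1) + j"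
    using \<open>k < m\<close> by (simp add: of_nat_diff algebra_simps)
  finally have "p dvd i * (int (m - k) * j - 1) + j"
    using p(3) dvd_trans by blast
  then have "p dvd j"
    using p(2) by (metis dvd_add_right_iff dvd_mult)
  then have "p dvd int (m - k) * j"
    by simp
  with p(2) have "p dvd 1"
    by (metis dvd_diff_right_iff)
  with p(1) show False
    by (simp add: not_prime_unit)
qed

text \<open>A row (1, i) proportional to (j, m j - 1) would give (m - i) j = 1, although
  \<open>j\<close> is no unit. For two rows of the second kind, \<open>shift_unique\<close> in both
  directions forces equal shifts, and the congruence then reduces to i = j modulo
  \<open>N\<close>.\<close>

lemma rows_unique:
  assumes N: "N > 1" and v: "valid N i q" "valid N j r"
    and eq: "[row1 i q * row2 j r = row2 i q * row1 j r] (mod N)"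
  shows "i = j \<and> q = r"
proof -
  have mixed: False if "valid N i None" "valid N j (Some m)"
    "[int m * j - 1 = i * j] (mod N)" for i j m
  proof -
    have "[(int m - i) * j = 1] (mod N)"
      using that(3) by (simp add: cong_iff_dvd_diff algebra_simps)
    then have "coprime j N"
      by (metis coprime_iff_invertible_int mult.commute)
    with that(2) show False
      by (simp add: coprime_iff_gcd_eq_1)
  qed
  show ?thesis
  proof (cases q; cases r)
    assume "q = None" "r = None"
    then show ?thesis
      using v eq eq_in_range[OF N, of i j] by (simp add: cong_sym_eq)
  next
    fix m assume "q = None" "r = Some m"
    then show ?thesis
      using v eq mixed[of i j m] by simp
  next
    fix m assume "q = Some m" "r = None"
    then show ?thesis
      using v eq mixed[of j i m] by (simp add: mult.commute cong_sym_eq)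
  next
    fix k m assume qr: "q = Some k" "r = Some m"
    have eq1: "[i * (int m * j - 1) = (int k * i - 1) * j] (mod N)"
      using eq qr by simp
    then have eq2: "[j * (int k * i - 1) = (int m * j - 1) * i] (mod N)"
      by (simp add: mult.commute cong_sym_eq)
    have "k = m"
      using shift_unique[OF N _ _ eq1] shift_unique[OF N _ _ eq2] v qr by fastforce
    then have "[i = j] (mod N)"
      using eq1 by (simp add: cong_iff_dvd_diff algebra_simps dvd_diff_commute)
    then have "i = j"
      using v qr eq_in_range[OF N, of i j] by simp
    with \<open>k = m\<close> qr show ?thesis
      by simp
  qed
qed

text \<open>Either \<open>row1\<close> is 1, or m \<open>row1\<close> - \<open>row2\<close> is 1; so
  the scalar in front of a row can be read off.\<close>

lemma row_cancel:
  assumes "[u * row1 j r = v * row1 j r] (mod N)" "[u * row2 j r = v * row2 j r] (mod N)"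
  shows "[u = v] (mod N)"
proof (cases r)
  case None
  with assms show ?thesis
    by simp
next
  case (Some m)
  have "[int m * (u * j) - u * (int m * j - 1) = int m * (v * j) - v * (int m * j - 1)] (mod N)"
    using assms unfolding Some row1.simps row2.simps
    by (intro cong_diff[OF cong_mult[OF cong_refl]])
  then show ?thesis
    by (simp add: algebra_simps)
qed

section \<open>Connected unions of tiles\<close>

lemma SL2Z_denominator_nonzero:
  assumes "A \<in> carrier SL2Z" "Im z > 0"
  shows "of_int (A$2$1) * z + of_int (A$2$2) \<noteq> 0"
proof
  assume 0: "of_int (A$2$1) * z + of_int (A$2$2) = 0"
  then have "Im (of_int (A$2$1) * z + of_int (A$2$2)) = 0"
    by simp
  with assms(2) have c: "A$2$1 = 0"
    by simp
  with 0 have "A$2$2 = 0"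
    by simp
  with c assms(1) show False
    by (simp add: carrier_SL2Z)
qed

lemma Im_moebius:
  assumes "A \<in> carrier SL2Z" "Im z > 0"
  shows "Im (moebius A z) = Im z / (cmod (of_int (A$2$1) * z + of_int (A$2$2)))\<^sup>2"
proof -
  have det: "of_int (A$1$1) * of_int (A$2$2) - of_int (A$1$2) * of_int (A$2$1) = (1::real)"
    using assms(1) unfolding carrier_SL2Z by (metis of_int_1 of_int_diff of_int_mult)
  have "of_int (A$1$1) * Im z * (of_int (A$2$1) * Re z + of_int (A$2$2))
      - (of_int (A$1$1) * Re z + of_int (A$1$2)) * (of_int (A$2$1) * Im z)
      = (of_int (A$1$1) * of_int (A$2$2) - of_int (A$1$2) * of_int (A$2$1)) * Im z"
    by (simp add: algebra_simps)
  then show ?thesis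
    using det by (simp add: moebius_def Im_divide cmod_power2)
qed

lemma moebius_closed:
  assumes "A \<in> carrier SL2Z" "z \<in> upper_half_plane"
  shows "moebius A z \<in> upper_half_plane"
  using assms SL2Z_denominator_nonzero[of A z] by (simp add: upper_half_plane_def Im_moebius)

lemma moebius_mult:
  assumes "A \<in> carrier SL2Z" "B \<in> carrier SL2Z" "z \<in> upper_half_plane"
  shows "moebius (A ** B) z = moebius A (moebius B z)"
proof -
  have z: "Im z > 0"
    using assms(3) by (simp add: upper_half_plane_def)
  define q where "q = of_int (B$2$1) * z + of_int (B$2$2)"
  define p where "p = of_int (B$1$1) * z + of_int (B$1$2)"
  have q: "q \<noteq> 0"
    using SL2Z_denominator_nonzero[OF assms(2) z] by (simp add: q_def)
  have "moebius A (moebius B z)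
      = (of_int (A$1$1) * p + of_int (A$1$2) * q) / (of_int (A$2$1) * p + of_int (A$2$2) * q)"
  proof -
    have "x * (p / q) + y = (x * p + y * q) / q" for x y
      using q by (simp add: field_simps)
    then show ?thesis
      using q by (simp only: moebius_def p_def[symmetric] q_def[symmetric]) simp
  qed
  then show ?thesis
    by (simp add: moebius_def mult_nth2 p_def q_def algebra_simps)
qed

lemma moebius_uminus [simp]: "moebius (- A) z = moebius A z"
proof -
  have "moebius (- A) z = (- (of_int (A$1$1) * z + of_int (A$1$2))) / (- (of_int (A$2$1) * z + of_int (A$2$2)))"
    by (simp add: moebius_def)
  then show ?thesis
    by (simp only: minus_divide_divide moebius_def)
qed

lemma moebius_one [simp]: "moebius (mat 1) z = z"
  by (simp add: moebius_def)

lemma continuous_on_moebius: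
  assumes "A \<in> carrier SL2Z"
  shows "continuous_on upper_half_plane (moebius A)"
  unfolding moebius_def using SL2Z_denominator_nonzero[OF assms]
  by (intro continuous_intros) (auto simp: upper_half_plane_def)

lemma open_upper_half_plane: "open upper_half_plane"
  unfolding upper_half_plane_def by (rule open_halfspace_Im_gt)

text \<open>The image under \<open>A\<close> is the preimage under the continuous map given by
  \<open>adj2 A\<close>.\<close>

lemma open_moebius_image:
  assumes A: "A \<in> carrier SL2Z" and "open K" and K: "K \<subseteq> upper_half_plane"
  shows "open (moebius A ` K)"
proof -
  have "moebius A ` K = upper_half_plane \<inter> moebius (adj2 A) -` K"
  proof (intro subset_antisym subsetI)
    fix w assume "w \<in> moebius A ` K"
    then obtain z where z: "z \<in> K" "w = moebius A z"
      by blast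
    moreover have "moebius (adj2 A) (moebius A z) = z"
      using A z K by (subst moebius_mult[symmetric]) auto
    ultimately show "w \<in> upper_half_plane \<inter> moebius (adj2 A) -` K"
      using A K moebius_closed by auto
  next
    fix w assume "w \<in> upper_half_plane \<inter> moebius (adj2 A) -` K"
    moreover from this have "moebius A (moebius (adj2 A) w) = w"
      using A by (subst moebius_mult[symmetric]) auto
    ultimately show "w \<in> moebius A ` K"
      by (metis IntE image_eqI vimageE)
  qed
  moreover have "open (upper_half_plane \<inter> moebius (adj2 A) -` K)"
    using A by (intro continuous_open_preimage continuous_on_moebius open_upper_half_plane assms) auto
  ultimately show ?thesis
    by simp
qed

section \<open>Topology of the tile \<open>fund_D\<close>\<close>

lemma fund_D_subset: "fund_D \<subseteq> upper_half_plane"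
  by (auto simp: fund_D_def)

lemma open_fund_D: "open fund_D"
proof -
  have "fund_D = {z. Im z > 0} \<inter> {z. cmod z > 1} \<inter> {z. \<bar>Re z\<bar> < 1/2}"
    by (auto simp: fund_D_def upper_half_plane_def)
  moreover have "open \<dots>"
    by (intro open_Int open_Collect_less continuous_intros)
  ultimately show ?thesis
    by simp
qed

text \<open>The set is not convex, but it is the image of the convex half-strip \<open>R\<close>
  under the map raising each point by the height of the unit circle above its real part.\<close>

lemma connected_fund_D: "connected fund_D"
proof -
  define f where "f = (\<lambda>w. Complex (Re w) (sqrt (1 - (Re w)\<^sup>2) + Im w))"
  define R where "R = {w. - 1/2 < Re w} \<inter> {w. Re w < 1/2} \<inter> {w. Im w > 0}"
  have sq: "(Re w)\<^sup>2 < 1" if "\<bar>Re w\<bar> < 1/2" for w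
    using that by (simp add: abs_square_less_1)
  have "fund_D = f ` R"
  proof (intro subset_antisym subsetI)
    fix z assume "z \<in> fund_D"
    then have z: "Im z > 0" "cmod z > 1" "\<bar>Re z\<bar> < 1/2"
      by (auto simp: fund_D_def upper_half_plane_def)
    have "1 < (cmod z)\<^sup>2"
      using z(2) by (simp add: one_less_power)
    then have "1 - (Re z)\<^sup>2 < (Im z)\<^sup>2"
      by (simp add: cmod_power2)
    then have "sqrt (1 - (Re z)\<^sup>2) < Im z"
      using z(1) by (simp add: real_less_lsqrt)
    then show "z \<in> f ` R"
      using z(3) by (intro image_eqI[of _ _ "Complex (Re z) (Im z - sqrt (1 - (Re z)\<^sup>2))"])
        (auto simp: f_def R_def)
  next
    fix z assume "z \<in> f ` R"
    then obtain w where w: "z = f w" "\<bar>Re w\<bar> < 1/2" "Im w > 0"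
      by (auto simp: R_def)
    have s: "sqrt (1 - (Re w)\<^sup>2) > 0"
      using sq[OF w(2)] by simp
    then have "(sqrt (1 - (Re w)\<^sup>2) + Im w)\<^sup>2 > (sqrt (1 - (Re w)\<^sup>2))\<^sup>2"
      using w(3) by (intro power_strict_mono) auto
    then have "(cmod z)\<^sup>2 > 1"
      using sq[OF w(2)] by (simp add: cmod_power2 w f_def)
    then have "cmod z > 1"
      by (metis norm_ge_zero one_power2 power2_less_imp_less)
    then show "z \<in> fund_D"
      using w s by (auto simp: fund_D_def upper_half_plane_def f_def intro: add_pos_pos)
  qed
  moreover have "continuous_on R f"
    unfolding f_def Complex_eq by (intro continuous_intros)
  moreover have "connected R"
    unfolding R_def
    by (intro convex_connected convex_Int convex_halfspace_Re_gt convex_halfspace_Re_lt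
        convex_halfspace_Im_gt)
  ultimately show ?thesis
    using connected_continuous_image by metis
qed

lemma closure_of_upper_half_plane:
  "top_of_set upper_half_plane closure_of S = upper_half_plane \<inter> closure (upper_half_plane \<inter> S)"
  by (simp add: closure_of_subtopology)

text \<open>From \<open>z\<close> the segment in direction (- Re z, 1) enters \<open>fund_D\<close>
  at once: it moves towards the imaginary axis and upwards, and the modulus grows. Only this
  inclusion is needed to cover neighbourhoods of edges.\<close>

lemma closure_fund_D:
  assumes "Im z > 0" "cmod z \<ge> 1" "\<bar>Re z\<bar> \<le> 1/2"
  shows "z \<in> top_of_set upper_half_plane closure_of fund_D"
proof -
  define f where "f t = z + of_real t * Complex (- Re z) 1" for t
  have f: "f t \<in> fund_D" if t: "0 < t" "t < 1" for t
  proof -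
    have Re: "Re (f t) = (1 - t) * Re z" and Im: "Im (f t) = Im z + t"
      by (simp_all add: f_def algebra_simps)
    have "\<bar>Re (f t)\<bar> = (1 - t) * \<bar>Re z\<bar>"
      using t by (simp add: Re abs_mult)
    also have "\<dots> \<le> (1 - t) * (1/2)"
      using t assms(3) by (intro mult_left_mono) auto
    also have "\<dots> < 1/2"
      using t by simp
    finally have 1: "\<bar>Re (f t)\<bar> < 1/2" .
    have x: "(Re z)\<^sup>2 \<le> 1/4"
      using power_mono[OF assms(3), of 2] by (simp add: power_divide)
    have "1\<^sup>2 \<le> (cmod z)\<^sup>2"
      using assms(2) by (intro power_mono) auto
    then have y: "(Im z)\<^sup>2 + (Re z)\<^sup>2 \<ge> 1"
      by (simp add: cmod_power2)
    with x have "(1/2)\<^sup>2 < (Im z)\<^sup>2"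
      by (simp add: power_divide)
    then have "1/2 < Im z"
      by (rule power2_less_imp_less) (use assms(1) in simp)
    \<comment> \<open>This is half the coefficient of t in the difference of the squared moduli of
      \<open>f t\<close> and \<open>z\<close>; the coefficient of the square of t is positive
      anyway.\<close>
    with x have "0 < Im z - (Re z)\<^sup>2"
      by linarith
    with t have "0 < 2 * t * (Im z - (Re z)\<^sup>2) + t\<^sup>2 + t\<^sup>2 * (Re z)\<^sup>2"
      by (intro add_pos_nonneg) auto
    also have "\<dots> = (cmod (f t))\<^sup>2 - ((Re z)\<^sup>2 + (Im z)\<^sup>2)"
      unfolding cmod_power2 Re Im by (simp add: power2_eq_square algebra_simps)
    finally have "1\<^sup>2 < (cmod (f t))\<^sup>2"
      using y by simp
    then have "1 < cmod (f t)"
      by (rule power2_less_imp_less) simp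
    with 1 show ?thesis
      using assms(1) t by (simp add: fund_D_def upper_half_plane_def Im)
  qed
  have "(f \<longlongrightarrow> f 0) (at_right 0)"
    unfolding f_def by (intro tendsto_intros)
  moreover have "\<forall>\<^sub>F t in at_right 0. f t \<in> closure fund_D"
    unfolding eventually_at_right_field
    by (intro exI[of _ 1]) (simp add: f closure_subset[THEN subsetD])
  ultimately have "f 0 \<in> closure fund_D"
    by (intro Lim_in_closed_set[OF closed_closure _ trivial_limit_at_right_real])
  then show ?thesis
    using assms(1) fund_D_subset
    by (simp add: closure_of_upper_half_plane inf_absorb2) (simp add: upper_half_plane_def f_def)
qed

section \<open>Unions of tiles and passage across common edges\<close>

definition tiles :: "(int^2^2) set \<Rightarrow> complex set" where
  "tiles L = top_of_set upper_half_plane interior_of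
     (\<Union>A\<in>L. top_of_set upper_half_plane closure_of (moebius A ` fund_D))"

lemma open_subset_tiles:
  assumes "open K" "K \<subseteq> (\<Union>A\<in>L. top_of_set upper_half_plane closure_of (moebius A ` fund_D))"
  shows "K \<subseteq> tiles L"
proof -
  have "K \<subseteq> upper_half_plane"
    using assms(2) closure_of_subset_topspace[of "top_of_set upper_half_plane"] by fastforce
  then have "openin (top_of_set upper_half_plane) K"
    using assms(1) open_upper_half_plane by (simp add: openin_open_eq)
  then show ?thesis
    unfolding tiles_def using assms(2) by (intro interior_of_maximal)
qed

lemma moebius_closure_subset:
  assumes "A \<in> carrier SL2Z"
  shows "moebius A ` (top_of_set upper_half_plane closure_of S)
    \<subseteq> top_of_set upper_half_plane closure_of (moebius A ` S)"
  by (intro continuous_map_image_closure_subset)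
    (use assms continuous_on_moebius moebius_closed in auto)

lemma moebius_fund_D_subset_tiles:
  assumes "L \<subseteq> carrier SL2Z" "A \<in> L"
  shows "moebius A ` fund_D \<subseteq> tiles L"
proof (rule open_subset_tiles)
  have "moebius A ` fund_D \<subseteq> upper_half_plane"
    using assms fund_D_subset moebius_closed by blast
  then have "moebius A ` fund_D \<subseteq> top_of_set upper_half_plane closure_of (moebius A ` fund_D)"
    by (intro closure_of_subset) simp
  with assms(2) show "moebius A ` fund_D \<subseteq>
      (\<Union>A\<in>L. top_of_set upper_half_plane closure_of (moebius A ` fund_D))"
    by blast
qed (use assms open_moebius_image open_fund_D fund_D_subset in blast)

text \<open>Tiles are marked by the images of 2i, a point of \<open>fund_D\<close>. As -I acts
  trivially, the relation ignores signs of matrices.\<close>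

definition linked :: "(int^2^2) set \<Rightarrow> int^2^2 \<Rightarrow> int^2^2 \<Rightarrow> bool" where
  "linked L A B \<longleftrightarrow> connected_component (tiles L) (moebius A (2 * \<i>)) (moebius B (2 * \<i>))"

lemma linked_sym: "linked L A B \<Longrightarrow> linked L B A"
  unfolding linked_def by (rule connected_component_sym)

lemma linked_trans: "linked L A B \<Longrightarrow> linked L B C \<Longrightarrow> linked L A C"
  unfolding linked_def by (rule connected_component_trans)

lemma linked_uminus [simp]: "linked L (- A) B = linked L A B" "linked L A (- B) = linked L A B"
  by (simp_all add: linked_def)

lemma two_i_in_fund_D [simp]: "2 * \<i> \<in> fund_D"
  by (simp add: fund_D_def upper_half_plane_def norm_mult)

lemma linked_refl:
  assumes "L \<subseteq> carrier SL2Z" "A \<in> L"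
  shows "linked L A A"
  unfolding linked_def connected_component_refl_eq
  using moebius_fund_D_subset_tiles[OF assms] two_i_in_fund_D by blast

text \<open>Each point of the union lies in the closure of some tile. That tile with the point added
  lies between a connected set and its closure, so it is connected, and it stays inside
  \<open>tiles L\<close>. Thus every point is joined to a marked one.\<close>

lemma connected_tiles:
  assumes L: "L \<subseteq> carrier SL2Z" and linked: "\<And>A B. A \<in> L \<Longrightarrow> B \<in> L \<Longrightarrow> linked L A B"
  shows "connected (tiles L)"
proof -
  have *: "\<exists>A\<in>L. connected_component (tiles L) (moebius A (2 * \<i>)) z" if z: "z \<in> tiles L" for z
  proof -
    have "z \<in> (\<Union>A\<in>L. top_of_set upper_half_plane closure_of (moebius A ` fund_D))"
      using z interior_of_subset unfolding tiles_def by fast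
    then obtain A where A: "A \<in> L" "z \<in> top_of_set upper_half_plane closure_of (moebius A ` fund_D)"
      by blast
    have cl: "insert z (moebius A ` fund_D) \<subseteq> closure (moebius A ` fund_D)"
      using closure_subset[of "moebius A ` fund_D"] A(2) closure_mono[of "upper_half_plane \<inter> moebius A ` fund_D" "moebius A ` fund_D"]
      by (auto simp: closure_of_upper_half_plane)
    have "connected (moebius A ` fund_D)"
      using A L connected_fund_D fund_D_subset
      by (intro connected_continuous_image continuous_on_subset[OF continuous_on_moebius]) auto
    then have "connected (insert z (moebius A ` fund_D))"
      using subset_insertI cl by (rule connected_intermediate_closure)
    moreover have "insert z (moebius A ` fund_D) \<subseteq> tiles L"
      using z moebius_fund_D_subset_tiles[OF L A(1)] by simp
    ultimately show ?thesis
      using A(1) two_i_in_fund_D unfolding connected_component_def by blast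
  qed
  show ?thesis
    unfolding connected_iff_connected_component
    using * linked[unfolded linked_def] connected_component_trans connected_component_sym
    by (metis (no_types, lifting))
qed

text \<open>\<open>K\<close> is a connected open set joining the marked points of the tiles of I and
  \<open>B\<close>. Its image under \<open>A\<close> is open and covered by two closed tiles, hence
  contained in the interior of the union. Only the tile matters, so \<open>L\<close> may contain the
  negative of \<open>A ** B\<close> instead.\<close>

lemma linked_step:
  assumes L: "L \<subseteq> carrier SL2Z" "A \<in> L" "A ** B \<in> L \<or> - (A ** B) \<in> L" and B: "B \<in> carrier SL2Z"
    and K: "open K" "connected K" "2 * \<i> \<in> K" "moebius B (2 * \<i>) \<in> K"
    and cover: "K \<subseteq> top_of_set upper_half_plane closure_of fund_D \<union>
      moebius B ` (top_of_set upper_half_plane closure_of fund_D)"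
  shows "linked L A (A ** B)"
proof -
  have A: "A \<in> carrier SL2Z"
    using L by blast
  let ?cl = "\<lambda>S. top_of_set upper_half_plane closure_of S"
  have cl: "?cl S \<subseteq> upper_half_plane" for S
    using closure_of_subset_topspace[of "top_of_set upper_half_plane"] by fastforce
  then have H: "K \<subseteq> upper_half_plane"
    using cover moebius_closed[OF B] by blast
  have "moebius A ` K \<subseteq> moebius A ` ?cl fund_D \<union> moebius (A ** B) ` ?cl fund_D"
  proof -
    have "moebius A ` K \<subseteq> moebius A ` ?cl fund_D \<union> moebius A ` moebius B ` ?cl fund_D"
      using cover by blast
    moreover have "moebius A ` moebius B ` ?cl fund_D = moebius (A ** B) ` ?cl fund_D"
      unfolding image_image using A B cl by (intro image_cong refl moebius_mult[symmetric]) auto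
    ultimately show ?thesis
      by simp
  qed
  also have "\<dots> \<subseteq> ?cl (moebius A ` fund_D) \<union> ?cl (moebius (A ** B) ` fund_D)"
    using A B by (intro Un_mono moebius_closure_subset) auto
  also have "\<dots> \<subseteq> (\<Union>C\<in>L. ?cl (moebius C ` fund_D))"
  proof (intro Un_least)
    show "?cl (moebius A ` fund_D) \<subseteq> (\<Union>C\<in>L. ?cl (moebius C ` fund_D))"
      using L(2) by blast
    have "moebius (- (A ** B)) ` fund_D = moebius (A ** B) ` fund_D"
      by simp
    then show "?cl (moebius (A ** B) ` fund_D) \<subseteq> (\<Union>C\<in>L. ?cl (moebius C ` fund_D))"
      using L(3) by (metis UN_upper)
  qed
  finally have "moebius A ` K \<subseteq> tiles L"
    using A K(1) H by (intro open_subset_tiles open_moebius_image)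
  moreover have "connected (moebius A ` K)"
    using A K(2) H by (intro connected_continuous_image continuous_on_subset[OF continuous_on_moebius])
  moreover have "moebius (A ** B) (2 * \<i>) \<in> moebius A ` K"
    using A B K(4) by (subst moebius_mult) (auto simp: upper_half_plane_def)
  ultimately show ?thesis
    using K(3) unfolding linked_def connected_component_def by blast
qed

lemma linked_T:
  assumes L: "L \<subseteq> carrier SL2Z" "A \<in> L" "A ** matT \<in> L \<or> - (A ** matT) \<in> L"
  shows "linked L A (A ** matT)"
proof (rule linked_step[OF L matT_closed])
  \<comment> \<open>Above height 1 the condition on the modulus is automatic, so in this half-strip
    only the line Re z = 1/2 separates the two tiles. It contains 2i and 2i + 1.\<close>
  let ?K = "{z. -1/2 < Re z} \<inter> {z. Re z < 3/2} \<inter> {z. 1 < Im z}"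
  have T: "moebius matT z = z + 1" for z
    by (simp add: moebius_def matT_eq)
  show "open ?K"
    by (intro open_Int open_halfspace_Re_gt open_halfspace_Re_lt open_halfspace_Im_gt)
  show "connected ?K"
    by (intro convex_connected convex_Int convex_halfspace_Re_gt convex_halfspace_Re_lt
        convex_halfspace_Im_gt)
  show "2 * \<i> \<in> ?K" "moebius matT (2 * \<i>) \<in> ?K"
    by (simp_all add: T)
  show "?K \<subseteq> top_of_set upper_half_plane closure_of fund_D \<union>
      moebius matT ` (top_of_set upper_half_plane closure_of fund_D)"
  proof
    fix z assume z: "z \<in> ?K"
    have far: "cmod w \<ge> 1" if "Im w > 1" for w
      using abs_Im_le_cmod[of w] that by linarith
    show "z \<in> top_of_set upper_half_plane closure_of fund_D \<union>
      moebius matT ` (top_of_set upper_half_plane closure_of fund_D)"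
    proof (cases "Re z \<le> 1/2")
      case True
      with z far[of z] show ?thesis
        by (intro UnI1 closure_fund_D) auto
    next
      case False
      then have "\<bar>Re (z - 1)\<bar> \<le> 1/2"
        using z by (intro abs_leI) auto
      with z far[of "z - 1"] have "z - 1 \<in> top_of_set upper_half_plane closure_of fund_D"
        by (intro closure_fund_D) auto
      then show ?thesis
        by (intro UnI2 image_eqI[of _ _ "z - 1"]) (auto simp: T)
    qed
  qed
qed

lemma linked_S:
  assumes L: "L \<subseteq> carrier SL2Z" "A \<in> L" "A ** matS \<in> L \<or> - (A ** matS) \<in> L"
  shows "linked L A (A ** matS)"
proof (rule linked_step[OF L matS_closed])
  \<comment> \<open>The box contains 2i and i/2. Height above 1/4 gives a squared modulus above
    1/16, so the width 1/32 keeps the real part of -1/z within 1/2.\<close>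
  let ?K = "{z. -1/32 < Re z} \<inter> {z. Re z < 1/32} \<inter> {z. 1/4 < Im z} \<inter> {z. Im z < 3}"
  have S: "moebius matS z = - 1 / z" for z
    by (simp add: moebius_def matS_eq)
  show "open ?K"
    by (intro open_Int open_halfspace_Re_gt open_halfspace_Re_lt open_halfspace_Im_gt
        open_halfspace_Im_lt)
  show "connected ?K"
    by (intro convex_connected convex_Int convex_halfspace_Re_gt convex_halfspace_Re_lt
        convex_halfspace_Im_gt convex_halfspace_Im_lt)
  show "2 * \<i> \<in> ?K"
    by simp
  have "- 1 / (2 * \<i>) = \<i> / 2"
    by (simp add: complex_eq_iff Re_divide Im_divide)
  then show "moebius matS (2 * \<i>) \<in> ?K"
    by (simp add: S)
  show "?K \<subseteq> top_of_set upper_half_plane closure_of fund_D \<union>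
      moebius matS ` (top_of_set upper_half_plane closure_of fund_D)"
  proof
    fix z assume z: "z \<in> ?K"
    show "z \<in> top_of_set upper_half_plane closure_of fund_D \<union>
      moebius matS ` (top_of_set upper_half_plane closure_of fund_D)"
    proof (cases "cmod z \<ge> 1")
      case True
      with z show ?thesis
        by (intro UnI1 closure_fund_D) auto
    next
      case False
      have nz: "z \<noteq> 0"
        using z by auto
      have "(1/4)\<^sup>2 < (Im z)\<^sup>2"
        using z by (intro power_strict_mono) auto
      then have r: "(cmod z)\<^sup>2 > 1/16"
        by (simp add: cmod_power2 power_divide add_pos_nonneg add_strict_increasing2)
      have Re: "Re (- 1 / z) = - Re z / (cmod z)\<^sup>2" and Im: "Im (- 1 / z) = Im z / (cmod z)\<^sup>2"
        by (simp_all add: Re_divide Im_divide cmod_power2)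
      have "\<bar>Re z\<bar> \<le> 1/2 * (cmod z)\<^sup>2"
        using z r by auto
      then have "\<bar>Re (- 1 / z)\<bar> \<le> 1/2"
        unfolding Re abs_divide using r by (simp add: divide_le_eq)
      moreover have "Im (- 1 / z) > 0"
        unfolding Im using z nz by auto
      moreover have "cmod (- 1 / z) \<ge> 1"
        using False nz by (simp add: norm_divide)
      ultimately have "- 1 / z \<in> top_of_set upper_half_plane closure_of fund_D"
        by (intro closure_fund_D)
      then show ?thesis
        using nz by (intro UnI2 image_eqI[of _ _ "- 1 / z"]) (auto simp: S)
    qed
  qed
qed

lemma linked_T_pow:
  assumes L: "L \<subseteq> carrier SL2Z" and seg: "\<And>t. a \<le> t \<Longrightarrow> t \<le> b \<Longrightarrow> A ** T_pow t \<in> L"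
    and "a \<le> i" "i \<le> j" "j \<le> b"
  shows "linked L (A ** T_pow i) (A ** T_pow j)"
  using \<open>i \<le> j\<close> \<open>j \<le> b\<close>
proof (induction j rule: int_ge_induct)
  case base
  then show ?case
    using seg \<open>a \<le> i\<close> by (intro linked_refl L) auto
next
  case (step k)
  have "A ** T_pow k ** matT = A ** T_pow (k + 1)"
    by (simp add: T_pow_add T_pow_1 matrix_mul_assoc)
  then have "linked L (A ** T_pow k) (A ** T_pow (k + 1))"
    using linked_T[OF L, of "A ** T_pow k"] seg[of k] seg[of "k + 1"] step \<open>a \<le> i\<close> by simp
  with step show ?case
    by (auto intro: linked_trans)
qed

section \<open>The three lists\<close>

lemma mem_pm_I: "A \<in> pm_I \<Gamma> \<longleftrightarrow> A \<in> \<Gamma> \<or> - A \<in> \<Gamma>"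
proof -
  have "A \<in> uminus ` \<Gamma> \<longleftrightarrow> - A \<in> \<Gamma>"
    by (metis image_iff minus_minus)
  then show ?thesis
    by (simp add: pm_I_eq)
qed

text \<open>Indexing the list by \<open>xs\<close> turns the coset conditions into injectivity and
  surjectivity of \<open>g\<close> with respect to the test \<open>A ** adj2 B\<close>; finite index
  follows from the inclusion of \<open>GammaN N\<close>.\<close>

lemma fundamental_listI:
  assumes \<Gamma>: "subgroup \<Gamma> SL2Z" "GammaN N \<subseteq> \<Gamma>" and N: "N > 0"
    and "distinct xs" and closed: "\<And>x. x \<in> set xs \<Longrightarrow> g x \<in> carrier SL2Z"
    and inj: "\<And>x y. x \<in> set xs \<Longrightarrow> y \<in> set xs \<Longrightarrow> g x ** adj2 (g y) \<in> pm_I \<Gamma> \<Longrightarrow> x = y"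
    and surj: "\<And>A. A \<in> carrier SL2Z \<Longrightarrow> \<exists>x\<in>set xs. g x ** adj2 A \<in> pm_I \<Gamma>"
    and linked: "\<And>x y. x \<in> set xs \<Longrightarrow> y \<in> set xs \<Longrightarrow> linked (g ` set xs) (g x) (g y)"
  shows "fundamental_list \<Gamma> (map g xs)"
proof -
  let ?c = "\<lambda>A. pm_I \<Gamma> #>\<^bsub>SL2Z\<^esub> A"
  note coset_eq = rcoset_eq_iff[OF subgroup_pm_I[OF \<Gamma>(1)]]
  have "inj_on (\<lambda>x. ?c (g x)) (set xs)"
    by (intro inj_onI inj) (use coset_eq closed in blast)+
  then have "distinct (map ?c (map g xs))"
    using \<open>distinct xs\<close> by (simp add: distinct_map comp_def)
  moreover have "set (map ?c (map g xs)) = rcosets\<^bsub>SL2Z\<^esub> (pm_I \<Gamma>)"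
  proof (intro subset_antisym subsetI)
    fix C assume "C \<in> set (map ?c (map g xs))"
    then show "C \<in> rcosets\<^bsub>SL2Z\<^esub> (pm_I \<Gamma>)"
      using closed by (auto simp: RCOSETS_def)
  next
    fix C assume "C \<in> rcosets\<^bsub>SL2Z\<^esub> (pm_I \<Gamma>)"
    then obtain A where A: "A \<in> carrier SL2Z" "C = ?c A"
      unfolding RCOSETS_def by blast
    obtain x where "x \<in> set xs" "g x ** adj2 A \<in> pm_I \<Gamma>"
      using surj[OF A(1)] by blast
    then have "x \<in> set xs" "C = ?c (g x)"
      using A coset_eq[OF closed A(1)] by auto
    then show "C \<in> set (map ?c (map g xs))"
      by simp
  qed
  moreover have "connected (tiles (g ` set xs))"
    using closed linked by (intro connected_tiles) auto
  ultimately show ?thesis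
    using closed \<Gamma>(1) finite_rcosets_SL2Z[OF \<Gamma> N]
    by (auto simp: fundamental_list_def tiles_def)
qed

text \<open>Bottom rows modulo \<open>N\<close> are \<open>u (row1 j r, row2 j r)\<close>, where the unit \<open>u\<close> ranges over
  representatives of the units modulo sign: \<open>1\<close> and the \<open>k\<close> of the third item of the list.\<close>

fun Theta_elem :: "int \<Rightarrow> (int \<Rightarrow> int) \<Rightarrow> int \<times> int \<times> nat option \<Rightarrow> int^2^2" where
  "Theta_elem N kinv (u, j, None) =
     (if u = 1 then matS ** T_pow j
      else matS ** T_pow u ** matS ** T_pow (tilde N (kinv u + j)))"
| "Theta_elem N kinv (u, j, Some m) =
     (if u = 1 then matS ** T_pow j ** matS ** T_pow (int m)
      else matS ** T_pow u ** matS ** T_pow (tilde N (kinv u + j)) ** matS ** T_pow (int m))"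

definition unit_rep :: "int \<Rightarrow> int \<Rightarrow> bool" where
  "unit_rep N u \<longleftrightarrow> u = 1 \<or> - N1 N \<le> u \<and> u \<le> -2 \<and> gcd u N = 1"

definition index0 :: "int \<Rightarrow> (int \<times> int \<times> nat option) list" where
  "index0 N = [(1, i, None). i \<leftarrow> [- N1 N..N2 N]] @
     [(1, j, Some m). j \<leftarrow> [- N1 N..N2 N], gcd j N > 1, m \<leftarrow> [0..<Suc (M_max N j)]]"

text \<open>The bottom row \<open>(k, k i - 1)\<close> of \<open>S T\<^sup>k S T\<^sup>i\<close> is \<open>k (1, i - k\<inverse>)\<close> modulo \<open>N\<close>, whence the shift of
  \<open>i\<close> in the index.\<close>

definition index1 :: "int \<Rightarrow> (int \<Rightarrow> int) \<Rightarrow> (int \<times> int \<times> nat option) list" where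
  "index1 N kinv = index0 N @
     [(k, tilde N (i - kinv k), None). k \<leftarrow> [- N1 N..-2], gcd k N = 1, i \<leftarrow> [- N1 N..N2 N]] @
     [(k, j, Some m). k \<leftarrow> [- N1 N..-2], gcd k N = 1,
        j \<leftarrow> [- N1 N..N2 N], gcd j N > 1, m \<leftarrow> [0..<Suc (M_max N j)]]"

section \<open>The index lists and the bottom rows of their matrices\<close>

lemma tilde_eqI:
  assumes "N > 1" "[x = y] (mod N)" "- N1 N \<le> y" "y \<le> N2 N"
  shows "tilde N x = y"
  using tilde_props[OF assms(1), of x] assms by (intro eq_in_range[OF assms(1)]) (auto intro: cong_trans)

text \<open>Translation by \<open>a\<close> followed by reduction permutes the range, and
  translation by \<open>- a\<close> undoes it. This converts between the exponent i of S T^k S T^i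
  and its index.\<close>

lemma tilde_shift:
  assumes N: "N > 1" and "- N1 N \<le> j" "j \<le> N2 N"
  shows "tilde N (a + tilde N (j - a)) = j" "tilde N (tilde N (a + j) - a) = j"
proof -
  have "[a + tilde N (j - a) = a + (j - a)] (mod N)" "[tilde N (a + j) - a = a + j - a] (mod N)"
    by (intro cong_add cong_diff cong_refl tilde_props(1)[OF N])+
  then show "tilde N (a + tilde N (j - a)) = j" "tilde N (tilde N (a + j) - a) = j"
    using assms by (auto intro!: tilde_eqI)
qed

lemma distinct_concat_map:
  assumes "distinct xs" "\<And>x. x \<in> set xs \<Longrightarrow> distinct (f x)"
    "\<And>x y. x \<in> set xs \<Longrightarrow> y \<in> set xs \<Longrightarrow> x \<noteq> y \<Longrightarrow> set (f x) \<inter> set (f y) = {}"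
  shows "distinct (concat (map f xs))"
  using assms by (induction xs) fastforce+

lemma set_index0: "set (index0 N) = {(u, j, r). u = 1 \<and> valid N j r}"
proof -
  have "(u, j, r) \<in> set (index0 N) \<longleftrightarrow> u = 1 \<and> valid N j r" for u j r
    by (cases r) (auto simp: index0_def less_Suc_eq_le image_iff simp del: upt_Suc)
  then show ?thesis
    by auto
qed

lemma set_index1:
  assumes "N > 1"
  shows "set (index1 N kinv) = {(u, j, r). unit_rep N u \<and> valid N j r}"
proof -
  have "(u, j, r) \<in> set (index1 N kinv) \<longleftrightarrow> unit_rep N u \<and> valid N j r" for u j r
  proof (cases r)
    case None
    have "(\<exists>i\<in>{- N1 N..N2 N}. j = tilde N (i - kinv u)) \<longleftrightarrow> - N1 N \<le> j \<and> j \<le> N2 N"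
    proof
      assume "- N1 N \<le> j \<and> j \<le> N2 N"
      then show "\<exists>i\<in>{- N1 N..N2 N}. j = tilde N (i - kinv u)"
        using tilde_props[OF assms] tilde_shift(2)[OF assms, of j "kinv u"]
        by (intro bexI[of _ "tilde N (kinv u + j)"]) auto
    qed (use tilde_props[OF assms] in auto)
    then show ?thesis
      unfolding index1_def set_append Un_iff set_index0
      using None by (auto simp: unit_rep_def image_iff simp del: upt_Suc)
  next
    case (Some m)
    then show ?thesis
      unfolding index1_def set_append Un_iff set_index0
      by (auto simp: unit_rep_def less_Suc_eq_le image_iff simp del: upt_Suc)
  qed
  then show ?thesis
    by auto
qed

lemma distinct_index0: "distinct (index0 N)"
  unfolding index0_def distinct_append
  by (auto simp: distinct_map inj_on_def simp del: upt_Suc intro!: distinct_concat_map)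

lemma distinct_index1:
  assumes "N > 1"
  shows "distinct (index1 N kinv)"
proof -
  let ?A = "[(k, tilde N (i - kinv k), None :: nat option).
      k \<leftarrow> [- N1 N..-2], gcd k N = 1, i \<leftarrow> [- N1 N..N2 N]]"
  let ?B = "[(k, j, Some m). k \<leftarrow> [- N1 N..-2], gcd k N = 1,
      j \<leftarrow> [- N1 N..N2 N], gcd j N > 1, m \<leftarrow> [0..<Suc (M_max N j)]]"
  have inj: "i = j" if "tilde N (i - a) = tilde N (j - a)" "i \<in> {- N1 N..N2 N}" "j \<in> {- N1 N..N2 N}" for i j a
    using that tilde_shift(1)[OF assms, of _ a] by (metis atLeastAtMost_iff)
  have A: "distinct ?A"
  proof (rule distinct_concat_map)
    fix k :: int
    show "distinct (if gcd k N = 1 then map (\<lambda>i. (k, tilde N (i - kinv k), None :: nat option)) [- N1 N..N2 N] else [])"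
      using inj by (auto simp: distinct_map intro!: inj_onI)
  qed auto
  have B: "distinct ?B"
    by (auto simp: distinct_map inj_on_def simp del: upt_Suc intro!: distinct_concat_map)
  have "set (index0 N) \<inter> set ?A = {}" "set (index0 N) \<inter> set ?B = {}" "set ?A \<inter> set ?B = {}"
    unfolding set_index0 by (auto simp del: upt_Suc)
  then show ?thesis
    unfolding index1_def distinct_append set_append using distinct_index0 A B by blast
qed

lemma Theta0_eq: "Theta0 N = map (Theta_elem N kinv) (index0 N)"
  by (simp add: Theta0_def index0_def map_concat comp_def if_distrib[of "map _"] cong: if_cong del: upt_Suc)

text \<open>The indices are listed in the order of the matrices. For k at most -2 the second branch
  of \<open>Theta_elem\<close> applies, and in the entries with \<open>None\<close> its shift by
  \<open>kinv k\<close> undoes the one in \<open>index1\<close>.\<close>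

lemma Theta1_eq:
  assumes "N > 1"
  shows "Theta1 N kinv = map (Theta_elem N kinv) (index1 N kinv)"
proof -
  have 1: "map (\<lambda>i. matS ** T_pow k ** matS ** T_pow i) [- N1 N..N2 N] =
      map (Theta_elem N kinv) (map (\<lambda>i. (k, tilde N (i - kinv k), None)) [- N1 N..N2 N])"
    if "k \<le> -2" for k
    using that tilde_shift(1)[OF assms] by simp
  have 2: "[matS ** T_pow k ** matS ** T_pow (tilde N (kinv k + j)) ** matS ** T_pow (int m).
        j \<leftarrow> [- N1 N..N2 N], gcd j N > 1, m \<leftarrow> [0..<Suc (M_max N j)]] =
      map (Theta_elem N kinv) [(k, j, Some m).
        j \<leftarrow> [- N1 N..N2 N], gcd j N > 1, m \<leftarrow> [0..<Suc (M_max N j)]]"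
    if "k \<le> -2" for k
    using that by (simp add: map_concat comp_def if_distrib[of "map _"] cong: if_cong del: upt_Suc)
  have "Theta1 N kinv = Theta0 N @
     [matS ** T_pow k ** matS ** T_pow i.
        k \<leftarrow> [- N1 N..-2], gcd k N = 1, i \<leftarrow> [- N1 N..N2 N]] @
     [matS ** T_pow k ** matS ** T_pow (tilde N (kinv k + j)) ** matS ** T_pow (int m).
        k \<leftarrow> [- N1 N..-2], gcd k N = 1,
        j \<leftarrow> [- N1 N..N2 N], gcd j N > 1, m \<leftarrow> [0..<Suc (M_max N j)]]"
    by (simp add: Theta1_def Theta0_def del: upt_Suc)
  also have "\<dots> = map (Theta_elem N kinv) (index1 N kinv)"
    unfolding index1_def map_append Theta0_eq[of N kinv] map_concat[of _ "map _ [- N1 N..-2]"] map_map[of "map _"] comp_def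
    by (intro arg_cong2[of _ _ _ _ append] refl arg_cong[of _ _ concat] map_cong)
      (simp_all only: if_distrib[of "map (Theta_elem N kinv)"] list.map 1 2 set_upto atLeastAtMost_iff)
  finally show ?thesis .
qed

lemma ThetaN_eq:
  assumes "N > 1"
  shows "ThetaN N kinv =
    map (\<lambda>(l, x). T_pow l ** Theta_elem N kinv x) (List.product [- N1 N..N2 N] (index1 N kinv))"
  by (simp add: ThetaN_def Theta1_eq[OF assms] product_concat_map map_concat comp_def)

lemma Theta_elem_closed [simp]: "Theta_elem N kinv x \<in> carrier SL2Z"
  by (cases "(N, kinv, x)" rule: Theta_elem.cases) auto

text \<open>The bottom row of S T^u S T^t is (u, u t - 1), which is u (1, j) for t = 1/u + j. A
  further S T^m turns it into (u t - 1, m (u t - 1) - u), which is u (j, m j - 1).\<close>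

lemma Theta_elem_row:
  assumes N: "N > 1" and u: "u \<noteq> 1 \<Longrightarrow> [u * kinv u = 1] (mod N)"
  shows "[Theta_elem N kinv (u, j, r) $ 2 $ 1 = u * row1 j r] (mod N)"
    "[Theta_elem N kinv (u, j, r) $ 2 $ 2 = u * row2 j r] (mod N)"
proof -
  have "[Theta_elem N kinv (u, j, r) $ 2 $ 1 = u * row1 j r] (mod N) \<and>
      [Theta_elem N kinv (u, j, r) $ 2 $ 2 = u * row2 j r] (mod N)"
  proof (cases "u = 1")
    case True
    then show ?thesis
      by (cases r) (simp_all add: mult_nth2 matS_eq T_pow_eq algebra_simps)
  next
    case False
    define t where "t = tilde N (kinv u + j)"
    have "[u * t = u * (kinv u + j)] (mod N)"
      unfolding t_def by (intro cong_mult cong_refl tilde_props N)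
    also have "u * (kinv u + j) = u * kinv u + u * j"
      by (simp add: algebra_simps)
    also have "[u * kinv u + u * j = 1 + u * j] (mod N)"
      using u[OF False] by (intro cong_add cong_refl)
    finally have "[u * t - 1 = 1 + u * j - 1] (mod N)"
      by (intro cong_diff cong_refl)
    then have ut: "[u * t - 1 = u * j] (mod N)"
      by simp
    have "[int m * (u * t - 1) - u = int m * (u * j) - u] (mod N)" for m
      by (intro cong_diff cong_mult cong_refl ut)
    moreover have "tilde N (kinv u + j) = t" "tilde N (j + kinv u) = t"
      by (simp_all add: t_def add.commute)
    ultimately show ?thesis
      using ut False by (cases r) (simp_all add: mult_nth2 matS_eq T_pow_eq algebra_simps)
  qed
  then show "[Theta_elem N kinv (u, j, r) $ 2 $ 1 = u * row1 j r] (mod N)"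
    "[Theta_elem N kinv (u, j, r) $ 2 $ 2 = u * row2 j r] (mod N)"
    by auto
qed

section \<open>Representatives of the units modulo sign\<close>

lemma N1_N2:
  assumes "N > 1"
  shows "0 \<le> N1 N" "N1 N \<le> N2 N" "1 \<le> N2 N"
  using assms by (auto simp: N1_def N2_def)

lemma unit_rep_coprime: "unit_rep N u \<Longrightarrow> coprime u N"
  by (auto simp: unit_rep_def coprime_iff_gcd_eq_1)

lemma unit_rep_exists:
  assumes N: "N > 1" and "coprime u N"
  obtains v where "unit_rep N v" "[u = v] (mod N) \<or> [- u = v] (mod N)"
proof -
  obtain w where w: "[w = u] (mod N)" "- N1 N \<le> w" "w \<le> N2 N"
    using exists_in_range[OF N] by blast
  have cop: "gcd w N = 1"
    using coprime_cong_int[OF w(1)] assms(2) by (simp add: coprime_iff_gcd_eq_1)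
  then have "w \<noteq> 0"
    using N by auto
  then consider "w = 1" | "w = -1" | "w \<le> -2" | "w \<ge> 2"
    by linarith
  then show ?thesis
  proof cases
    case 4
    \<comment> \<open>For even \<open>N\<close> the endpoint N/2 of the range has no negative in it;
      but N/2 divides \<open>N\<close>, so it is no unit once it is at least 2.\<close>
    have "w \<le> N1 N"
    proof (rule ccontr)
      assume "\<not> w \<le> N1 N"
      then have "w = N2 N" "N = 2 * N2 N"
        using w(3) by (auto simp: N1_def N2_def)
      then have "w dvd N"
        by (metis dvd_triv_right)
      with cop 4 show False
        by (simp add: gcd_proj1_if_dvd)
    qed
    moreover have "[- u = - w] (mod N)"
      using w(1) by (simp add: cong_minus_minus_iff cong_sym)
    ultimately show ?thesis
      using 4 cop by (intro that[of "- w"]) (auto simp: unit_rep_def)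
  next
    case 2
    then have "[- u = 1] (mod N)"
      using w(1) by (metis cong_minus_minus_iff cong_sym minus_minus)
    then show ?thesis
      by (intro that[of 1]) (auto simp: unit_rep_def)
  qed (use w cop in \<open>auto simp: unit_rep_def intro!: that[of w] intro: cong_sym\<close>)
qed

lemma unit_rep_unique:
  assumes N: "N > 1" and u: "unit_rep N u" and v: "unit_rep N v"
    and "[u = v] (mod N) \<or> [- u = v] (mod N)"
  shows "u = v"
proof (cases "[u = v] (mod N)")
  case True
  then show ?thesis
    using u v N1_N2[OF N] by (intro eq_in_range[OF N]) (auto simp: unit_rep_def)
next
  case False
  with assms have "[- u = v] (mod N)"
    by simp
  \<comment> \<open>Unless both are 1, \<open>N1 N\<close> is at least 2, so \<open>- u\<close> lies
    in the range and the congruence is an equality, which no two representatives satisfy.\<close>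
  then have "u \<noteq> 1 \<or> v \<noteq> 1 \<Longrightarrow> - u = v"
    using u v N1_N2[OF N]
      eq_in_range[OF N, of "- u" v] by (auto simp: unit_rep_def)
  then show ?thesis
    using u v by (auto simp: unit_rep_def)
qed

lemma mult_adj2_mem_pm_I:
  "A ** adj2 B \<in> pm_I \<Gamma> \<longleftrightarrow> A ** adj2 B \<in> \<Gamma> \<or> (- A) ** adj2 B \<in> \<Gamma>"
  by (simp add: mem_pm_I)

context
  fixes N :: int and kinv :: "int \<Rightarrow> int"
  assumes N: "N > 1"
    and kinv: "\<And>k. - N1 N \<le> k \<Longrightarrow> k \<le> -2 \<Longrightarrow> gcd k N = 1 \<Longrightarrow> [k * kinv k = 1] (mod N)"
begin

abbreviation "theta \<equiv> Theta_elem N kinv"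

lemma theta_row:
  assumes "unit_rep N u"
  shows "[theta (u, j, r) $ 2 $ 1 = u * row1 j r] (mod N)" "[theta (u, j, r) $ 2 $ 2 = u * row2 j r] (mod N)"
  using Theta_elem_row[OF N, of u kinv] kinv[of u] assms by (auto simp: unit_rep_def)

text \<open>The units \<open>u\<close> and \<open>v\<close> cancel from the vanishing determinant,
  which leaves \<open>rows_unique\<close>.\<close>

lemma theta_cross_unique:
  assumes u: "unit_rep N u" "unit_rep N v" and v: "valid N i q" "valid N j r"
    and eq: "[theta (u, i, q) $ 2 $ 1 * theta (v, j, r) $ 2 $ 2 = theta (u, i, q) $ 2 $ 2 * theta (v, j, r) $ 2 $ 1] (mod N)"
  shows "i = j \<and> q = r"
proof -
  have "[(u * row1 i q) * (v * row2 j r) = theta (u, i, q) $ 2 $ 1 * theta (v, j, r) $ 2 $ 2] (mod N)"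
    using theta_row u by (intro cong_mult cong_sym[OF theta_row(1)] cong_sym[OF theta_row(2)])
  also note eq
  also have "[theta (u, i, q) $ 2 $ 2 * theta (v, j, r) $ 2 $ 1 = (u * row2 i q) * (v * row1 j r)] (mod N)"
    using theta_row u by (intro cong_mult theta_row)
  finally have "[(u * v) * (row1 i q * row2 j r) = (u * v) * (row2 i q * row1 j r)] (mod N)"
    by (simp add: algebra_simps)
  moreover have "coprime (u * v) N"
    using u unit_rep_coprime by simp
  ultimately have "[row1 i q * row2 j r = row2 i q * row1 j r] (mod N)"
    by (simp add: cong_mult_lcancel)
  then show ?thesis
    by (rule rows_unique[OF N v])
qed

text \<open>Congruent rows are proportional, which fixes \<open>j\<close> and \<open>r\<close>.
  Cancelling the common row leaves e u = v modulo \<open>N\<close> with a sign e, and the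
  representatives are unique modulo sign.\<close>

lemma theta_row_unique:
  assumes x: "x \<in> set (index1 N kinv)" "y \<in> set (index1 N kinv)"
    and A: "A = theta x \<or> A = - theta x"
    and eq: "[A $ 2 $ 1 = theta y $ 2 $ 1] (mod N)" "[A $ 2 $ 2 = theta y $ 2 $ 2] (mod N)"
  shows "x = y"
proof -
  obtain u i q where x': "x = (u, i, q)" "unit_rep N u" "valid N i q"
    using x(1) by (auto simp: set_index1[OF N])
  obtain v j r where y': "y = (v, j, r)" "unit_rep N v" "valid N j r"
    using x(2) by (auto simp: set_index1[OF N])
  obtain e :: int where e: "e = 1 \<or> e = -1" "A $ 2 $ 1 = e * theta x $ 2 $ 1" "A $ 2 $ 2 = e * theta x $ 2 $ 2"
    using A by (metis mult_1 mult_minus1 vector_uminus_component)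
  have "[theta y $ 2 $ 2 * A $ 2 $ 1 = A $ 2 $ 2 * theta y $ 2 $ 1] (mod N)"
    using cong_mult[OF cong_sym[OF eq(2)] eq(1)] .
  then have "[theta x $ 2 $ 1 * theta y $ 2 $ 2 = theta x $ 2 $ 2 * theta y $ 2 $ 1] (mod N)"
    using e by (auto simp: cong_minus_minus_iff mult.commute)
  then have ij: "i = j" "q = r"
    using theta_cross_unique[OF x'(2) y'(2) x'(3) y'(3)] x'(1) y'(1) by auto
  have "[(e * u) * row1 j r = e * theta x $ 2 $ 1] (mod N)"
    using cong_mult[OF cong_refl cong_sym[OF theta_row(1)[OF x'(2)]], of e i q]
    by (simp add: x'(1) ij mult.assoc)
  also have "[e * theta x $ 2 $ 1 = v * row1 j r] (mod N)"
    using cong_trans[OF eq(1)[unfolded e] theta_row(1)[OF y'(2), of j r, folded y'(1)]] .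
  finally have 1: "[(e * u) * row1 j r = v * row1 j r] (mod N)" .
  have "[(e * u) * row2 j r = e * theta x $ 2 $ 2] (mod N)"
    using cong_mult[OF cong_refl cong_sym[OF theta_row(2)[OF x'(2)]], of e i q]
    by (simp add: x'(1) ij mult.assoc)
  also have "[e * theta x $ 2 $ 2 = v * row2 j r] (mod N)"
    using cong_trans[OF eq(2)[unfolded e] theta_row(2)[OF y'(2), of j r, folded y'(1)]] .
  finally have "[(e * u) * row2 j r = v * row2 j r] (mod N)" .
  with 1 have "[e * u = v] (mod N)"
    by (rule row_cancel)
  then have "u = v"
    using e(1) by (intro unit_rep_unique[OF N x'(2) y'(2)]) auto
  with ij x' y' show ?thesis
    by simp
qed

text \<open>Determinant 1 makes the bottom row primitive, so \<open>rows_exist\<close>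
  applies.\<close>

lemma bottom_row_decomposition:
  assumes "A \<in> carrier SL2Z"
  obtains u j r where "coprime u N" "valid N j r"
    "[A $ 2 $ 1 = u * row1 j r] (mod N)" "[A $ 2 $ 2 = u * row2 j r] (mod N)"
proof -
  let ?g = "gcd (A $ 2 $ 1) (gcd (A $ 2 $ 2) N)"
  have "?g dvd A $ 2 $ 1" "?g dvd A $ 2 $ 2"
    by (auto intro: dvd_trans[OF gcd_dvd2])
  then have "?g dvd A $ 1 $ 1 * A $ 2 $ 2 - A $ 1 $ 2 * A $ 2 $ 1"
    by (intro dvd_diff dvd_mult)
  then have "?g = 1"
    using assms by (simp add: carrier_SL2Z)
  then show ?thesis
    by (rule rows_exist[OF N]) (rule that)
qed

lemma theta_row_exists:
  assumes "A \<in> carrier SL2Z"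
  obtains x B where "x \<in> set (index1 N kinv)" "B = A \<or> B = - A"
    "[theta x $ 2 $ 1 = B $ 2 $ 1] (mod N)" "[theta x $ 2 $ 2 = B $ 2 $ 2] (mod N)"
proof -
  obtain u j r where u: "coprime u N" "valid N j r"
    and A: "[A $ 2 $ 1 = u * row1 j r] (mod N)" "[A $ 2 $ 2 = u * row2 j r] (mod N)"
    using bottom_row_decomposition[OF assms] by blast
  obtain v where v: "unit_rep N v" "[u = v] (mod N) \<or> [- u = v] (mod N)"
    using unit_rep_exists[OF N u(1)] by blast
  have x: "(v, j, r) \<in> set (index1 N kinv)"
    using v u by (simp add: set_index1[OF N])
  have lift: "[theta (v, j, r) $ 2 $ 1 = B $ 2 $ 1] (mod N) \<and> [theta (v, j, r) $ 2 $ 2 = B $ 2 $ 2] (mod N)"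
    if "[w = v] (mod N)" "[B $ 2 $ 1 = w * row1 j r] (mod N)" "[B $ 2 $ 2 = w * row2 j r] (mod N)" for w B
    using theta_row[OF v(1), of j r] cong_mult[OF that(1) cong_refl, of "row1 j r"]
      cong_mult[OF that(1) cong_refl, of "row2 j r"] that(2,3)
    by (meson cong_sym cong_trans)
  show ?thesis
  proof (cases "[u = v] (mod N)")
    case True
    then show ?thesis
      using that[OF x, of A] lift[OF True A] by blast
  next
    case False
    then have "[- u = v] (mod N)"
      using v by simp
    moreover have "[(- A) $ 2 $ 1 = - u * row1 j r] (mod N)" "[(- A) $ 2 $ 2 = - u * row2 j r] (mod N)"
      using A by (simp_all add: cong_minus_minus_iff)
    ultimately show ?thesis
      using that[OF x, of "- A"] lift[of "- u" "- A"] by blast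
  qed
qed

section \<open>Chains of adjacent tiles within the lists\<close>

lemma linked_segment:
  assumes "L \<subseteq> carrier SL2Z" "\<And>t. - N1 N \<le> t \<Longrightarrow> t \<le> N2 N \<Longrightarrow> A ** T_pow t \<in> L"
    and "- N1 N \<le> i" "i \<le> N2 N" "- N1 N \<le> j" "j \<le> N2 N"
  shows "linked L (A ** T_pow i) (A ** T_pow j)"
proof (cases "i \<le> j")
  case True
  then show ?thesis
    using assms by (intro linked_T_pow[where a = "- N1 N" and b = "N2 N"]) auto
next
  case False
  then show ?thesis
    using assms by (intro linked_sym[OF linked_T_pow[where a = "- N1 N" and b = "N2 N"]]) auto
qed

text \<open>One edge of type S followed by edges of type T. This is where it matters that the lists
  contain all exponents from 0 up to the given one.\<close>

lemma linked_ST_tail: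
  assumes L: "L \<subseteq> carrier SL2Z" "A \<in> L"
    and seg: "\<And>k. k \<le> m \<Longrightarrow> A ** matS ** T_pow (int k) \<in> L"
  shows "linked L A (A ** matS ** T_pow (int m))"
proof -
  have "A ** matS ** T_pow t \<in> L" if "0 \<le> t" "t \<le> int m" for t
    using seg[of "nat t"] that by simp
  then have "linked L (A ** matS ** T_pow 0) (A ** matS ** T_pow (int m))"
    by (intro linked_T_pow[OF L(1), where a = 0 and b = "int m"]) auto
  moreover have "linked L A (A ** matS)"
    using seg[of 0] by (intro linked_S L) (simp add: T_pow_0)
  ultimately show ?thesis
    by (auto simp: T_pow_0 intro: linked_trans)
qed

text \<open>The matrices C S T^i form a chain through C S, and at C S T^j the tail with exponents m
  branches off. The left factor \<open>C\<close> allows translates of the list.\<close>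

lemma linked_matS:
  assumes L: "L \<subseteq> carrier SL2Z" and mem: "\<And>j r. valid N j r \<Longrightarrow> C ** theta (1, j, r) \<in> L"
    and v: "valid N j r"
  shows "linked L (C ** matS) (C ** theta (1, j, r))"
proof -
  have mem': "C ** matS ** T_pow i \<in> L" if "- N1 N \<le> i" "i \<le> N2 N" for i
    using mem[of i None] that by (simp add: matrix_mul_assoc)
  have "- N1 N \<le> j" "j \<le> N2 N"
    using v by (cases r; simp)+
  then have 1: "linked L (C ** matS ** T_pow 0) (C ** matS ** T_pow j)"
    using linked_segment[OF L mem', of 0 j] N1_N2[OF N] by simp
  show ?thesis
  proof (cases r)
    case None
    with 1 show ?thesis
      by (simp add: T_pow_0 matrix_mul_assoc)
  next
    case (Some m)
    have "linked L (C ** matS ** T_pow j) (C ** matS ** T_pow j ** matS ** T_pow (int m))"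
    proof (rule linked_ST_tail[OF L])
      show "C ** matS ** T_pow j ** matS ** T_pow (int k) \<in> L" if "k \<le> m" for k
        using mem[of j "Some k"] v that Some by (simp add: matrix_mul_assoc)
    qed (use mem' v Some in auto)
    with 1 Some show ?thesis
      by (auto simp: T_pow_0 matrix_mul_assoc intro: linked_trans)
  qed
qed

text \<open>For u other than 1, \<open>A\<close> = C S T^u is on the chain through C S. An S edge
  leads from it to a second chain A S T^i, where again tails branch off.\<close>

lemma linked_matS':
  assumes L: "L \<subseteq> carrier SL2Z" and mem: "\<And>x. x \<in> set (index1 N kinv) \<Longrightarrow> C ** theta x \<in> L"
    and x: "x \<in> set (index1 N kinv)"
  shows "linked L (C ** matS) (C ** theta x)"
proof -
  obtain u j r where x_eq: "x = (u, j, r)" and u: "unit_rep N u" and v: "valid N j r"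
    using x by (auto simp: set_index1[OF N])
  have mem1: "C ** theta (1, j, r) \<in> L" if "valid N j r" for j r
    using mem[of "(1, j, r)"] that by (simp add: set_index1[OF N] unit_rep_def)
  show ?thesis
  proof (cases "u = 1")
    case True
    then show ?thesis
      using linked_matS[OF L mem1 v] x_eq by simp
  next
    case False
    define A where "A = C ** matS ** T_pow u"
    have u': "valid N u None"
      using u False N1_N2[OF N] by (auto simp: unit_rep_def)
    have 1: "linked L (C ** matS) A"
      using linked_matS[OF L mem1 u'] by (simp add: A_def matrix_mul_assoc)
    have A: "A \<in> L"
      using mem1[OF u'] by (simp add: A_def matrix_mul_assoc)
    \<comment> \<open>The index is chosen so that the shift by \<open>kinv u\<close> brings the
      exponent back to \<open>i\<close>.\<close>
    have mem': "A ** matS ** T_pow i \<in> L" if "- N1 N \<le> i" "i \<le> N2 N" for i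
      using mem[of "(u, tilde N (i - kinv u), None)"] that u False tilde_props[OF N] tilde_shift(1)[OF N that]
      by (simp add: A_def set_index1[OF N] matrix_mul_assoc)
    have "linked L A (A ** matS ** T_pow (int 0))"
      using mem'[of 0] N1_N2[OF N] by (intro linked_ST_tail[OF L A]) auto
    with 1 have 2: "linked L (C ** matS) (A ** matS ** T_pow 0)"
      by (auto intro: linked_trans)
    have 3: "linked L (C ** matS) (A ** matS ** T_pow i)" if "- N1 N \<le> i" "i \<le> N2 N" for i
      using 2 linked_segment[OF L mem', of 0 i] that N1_N2[OF N] by (auto intro: linked_trans)
    define t where "t = tilde N (kinv u + j)"
    have t: "- N1 N \<le> t" "t \<le> N2 N"
      unfolding t_def by (rule tilde_props[OF N])+
    show ?thesis
    proof (cases r)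
      case None
      with 3[OF t] False show ?thesis
        by (simp add: x_eq A_def t_def matrix_mul_assoc)
    next
      case (Some m)
      have "linked L (A ** matS ** T_pow t) (A ** matS ** T_pow t ** matS ** T_pow (int m))"
      proof (rule linked_ST_tail[OF L])
        show "A ** matS ** T_pow t ** matS ** T_pow (int k) \<in> L" if "k \<le> m" for k
          using mem[of "(u, j, Some k)"] u v that Some False
          by (simp add: A_def t_def set_index1[OF N] matrix_mul_assoc)
      qed (use mem' t in auto)
      with 3[OF t] Some False show ?thesis
        by (auto simp: x_eq A_def t_def matrix_mul_assoc intro: linked_trans)
    qed
  qed
qed

section \<open>The lists for \<open>Gamma0 N\<close>, \<open>Gamma1 N\<close> and
  \<open>GammaN N\<close>\<close>

lemma fundamental_list_Gamma0: "fundamental_list (Gamma0 N) (Theta0 N)"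
  unfolding Theta0_eq[of N kinv]
proof (rule fundamental_listI[OF subgroup_Gamma0])
  \<comment> \<open>Negating \<open>A\<close> negates both sides of the congruence, so adjoining -I
    does not change the condition.\<close>
  have mem0: "A ** adj2 B \<in> pm_I (Gamma0 N) \<longleftrightarrow> [A$2$1 * B$2$2 = A$2$2 * B$2$1] (mod N)"
    if "A \<in> carrier SL2Z" "B \<in> carrier SL2Z" for A B
    using that Gamma0_mult_adj2[of A B] Gamma0_mult_adj2[of "- A" B]
    by (auto simp: mult_adj2_mem_pm_I cong_minus_minus_iff simp del: uminus_mult_2)
  show "x = y" if x: "x \<in> set (index0 N)" "y \<in> set (index0 N)"
    and eq: "theta x ** adj2 (theta y) \<in> pm_I (Gamma0 N)" for x y
  proof -
    obtain i q j r where "x = (1, i, q)" "y = (1, j, r)" "valid N i q" "valid N j r"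
      using x by (auto simp: set_index0)
    then show ?thesis
      using theta_cross_unique[of 1 1 i q j r] eq by (simp add: mem0 unit_rep_def)
  qed
  show "\<exists>x\<in>set (index0 N). theta x ** adj2 A \<in> pm_I (Gamma0 N)" if A: "A \<in> carrier SL2Z" for A
  proof -
    obtain u j r where u: "coprime u N" "valid N j r"
      and row: "[A $ 2 $ 1 = u * row1 j r] (mod N)" "[A $ 2 $ 2 = u * row2 j r] (mod N)"
      using bottom_row_decomposition[OF A] by blast
    let ?x = "(1, j, r)"
    have one: "unit_rep N 1"
      by (simp add: unit_rep_def)
    have "[theta ?x $ 2 $ 1 * A $ 2 $ 2 = (1 * row1 j r) * (u * row2 j r)] (mod N)"
      by (intro cong_mult row theta_row one)
    also have "(1 * row1 j r) * (u * row2 j r) = (1 * row2 j r) * (u * row1 j r)"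
      by simp
    also have "[\<dots> = theta ?x $ 2 $ 2 * A $ 2 $ 1] (mod N)"
      by (rule cong_sym) (intro cong_mult row theta_row one)
    finally have "theta ?x ** adj2 A \<in> pm_I (Gamma0 N)"
      using A by (simp add: mem0)
    then show ?thesis
      using u by (intro bexI[of _ ?x]) (auto simp: set_index0)
  qed
  show "linked (theta ` set (index0 N)) (theta x) (theta y)"
    if "x \<in> set (index0 N)" "y \<in> set (index0 N)" for x y
  proof -
    have "linked (theta ` set (index0 N)) matS (theta x)" if mem: "x \<in> set (index0 N)" for x
    proof -
      obtain j r where x: "x = (1, j, r)" "valid N j r"
        using mem by (auto simp: set_index0)
      have "linked (theta ` set (index0 N)) (mat 1 ** matS) (mat 1 ** theta (1, j, r))"
        by (rule linked_matS) (use x in \<open>auto simp: set_index0\<close>)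
      then show ?thesis
        by (simp add: x(1) del: Theta_elem.simps)
    qed
    with that show ?thesis
      by (blast intro: linked_sym linked_trans)
  qed
qed (use N distinct_index0 in \<open>auto simp: GammaN_def Gamma0_def\<close>)

lemma mem_pm_I_Gamma1:
  assumes "A \<in> carrier SL2Z" "B \<in> carrier SL2Z"
  shows "A ** adj2 B \<in> pm_I (Gamma1 N) \<longleftrightarrow>
    (\<exists>A'. (A' = A \<or> A' = - A) \<and> [A'$2$1 = B$2$1] (mod N) \<and> [A'$2$2 = B$2$2] (mod N))"
  using assms Gamma1_mult_adj2[of A B] Gamma1_mult_adj2[of "- A" B]
  by (auto simp: mult_adj2_mem_pm_I simp del: uminus_mult_2)

lemma fundamental_list_Gamma1: "fundamental_list (Gamma1 N) (Theta1 N kinv)"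
  unfolding Theta1_eq[OF N]
proof (rule fundamental_listI[OF subgroup_Gamma1])
  show "x = y" if "x \<in> set (index1 N kinv)" "y \<in> set (index1 N kinv)"
    and "theta x ** adj2 (theta y) \<in> pm_I (Gamma1 N)" for x y
    using that theta_row_unique[OF that(1,2)] by (auto simp: mem_pm_I_Gamma1)
  show "\<exists>x\<in>set (index1 N kinv). theta x ** adj2 A \<in> pm_I (Gamma1 N)" if A: "A \<in> carrier SL2Z" for A
  proof -
    obtain x B where x: "x \<in> set (index1 N kinv)" "B = A \<or> B = - A"
      "[theta x $ 2 $ 1 = B $ 2 $ 1] (mod N)" "[theta x $ 2 $ 2 = B $ 2 $ 2] (mod N)"
      using theta_row_exists[OF A] by blast
    \<comment> \<open>The criterion puts the sign on the left factor, so it is moved from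
      \<open>A\<close> to \<open>theta x\<close>.\<close>
    have "[(- theta x) $ 2 $ 1 = A $ 2 $ 1] (mod N) \<and> [(- theta x) $ 2 $ 2 = A $ 2 $ 2] (mod N)" if "B = - A"
      using x(3,4) that cong_minus_minus_iff[of "- (theta x $ 2 $ 1)" "A $ 2 $ 1"]
        cong_minus_minus_iff[of "- (theta x $ 2 $ 2)" "A $ 2 $ 2"] by simp
    with x A show ?thesis
      by (intro bexI[of _ x]) (auto simp: mem_pm_I_Gamma1)
  qed
  show "linked (theta ` set (index1 N kinv)) (theta x) (theta y)"
    if "x \<in> set (index1 N kinv)" "y \<in> set (index1 N kinv)" for x y
  proof -
    have "linked (theta ` set (index1 N kinv)) matS (theta x)" if "x \<in> set (index1 N kinv)" for x
      using that linked_matS'[of "theta ` set (index1 N kinv)" "mat 1" x]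
      by (simp add: image_subset_iff)
    with that show ?thesis
      by (blast intro: linked_sym linked_trans)
  qed
qed (use N distinct_index1[OF N] in \<open>auto simp: GammaN_def Gamma1_def\<close>)

lemma mem_pm_I_GammaN:
  assumes "A \<in> carrier SL2Z" "B \<in> carrier SL2Z"
  shows "A ** adj2 B \<in> pm_I (GammaN N) \<longleftrightarrow> mat_cong N A B \<or> mat_cong N (- A) B"
  using assms GammaN_mult_adj2[of A B] GammaN_mult_adj2[of "- A" B]
  by (auto simp: mult_adj2_mem_pm_I simp del: uminus_mult_2)

lemma T_pow_mult_row: "(T_pow l ** A) $ 2 $ 1 = A $ 2 $ 1" "(T_pow l ** A) $ 2 $ 2 = A $ 2 $ 2"
  for A :: "int^2^2"
  by (simp_all add: T_pow_eq mult_nth2)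

lemma fundamental_list_GammaN: "fundamental_list (GammaN N) (ThetaN N kinv)"
  unfolding ThetaN_eq[OF N]
proof (rule fundamental_listI[OF subgroup_GammaN])
  let ?g = "\<lambda>(l, x). T_pow l ** theta x"
  let ?I = "List.product [- N1 N..N2 N] (index1 N kinv)"
  show "p = q" if pq: "p \<in> set ?I" "q \<in> set ?I" and "?g p ** adj2 (?g q) \<in> pm_I (GammaN N)" for p q
  proof -
    obtain l x where p: "p = (l, x)" "- N1 N \<le> l" "l \<le> N2 N" "x \<in> set (index1 N kinv)"
      by (cases p) (use pq in auto)
    obtain l' y where q: "q = (l', y)" "- N1 N \<le> l'" "l' \<le> N2 N" "y \<in> set (index1 N kinv)"
      by (cases q) (use pq in auto)
    have "mat_cong N (T_pow l ** theta x) (T_pow l' ** theta y) \<or> mat_cong N (- (T_pow l ** theta x)) (T_pow l' ** theta y)"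
      using that by (simp add: p q mem_pm_I_GammaN)
    then obtain X where X: "X = theta x \<or> X = - theta x" "mat_cong N (T_pow l ** X) (T_pow l' ** theta y)"
      by (metis uminus_mult_2(2))
    then have "x = y"
      using theta_row_unique[OF p(4) q(4) X(1)] by (simp add: mat_cong_iff T_pow_mult_row)
    have "mat_cong N (T_pow l ** X ** adj2 (theta x)) (T_pow l' ** theta y ** adj2 (theta x))"
      by (rule mat_cong_mult[OF X(2) mat_cong_refl])
    then have "mat_cong N (T_pow l ** (X ** adj2 (theta x))) (T_pow l' ** (theta x ** adj2 (theta x)))"
      by (simp only: matrix_mul_assoc \<open>x = y\<close>)
    moreover have "X ** adj2 (theta x) = mat 1 \<or> X ** adj2 (theta x) = - mat 1"
      using X(1) by auto
    ultimately have "mat_cong N (T_pow l) (T_pow l') \<or> mat_cong N (- T_pow l) (T_pow l')"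
      by auto
    then have "[l = l'] (mod N)"
    proof
      assume "mat_cong N (- T_pow l) (T_pow l')"
      \<comment> \<open>The diagonal entries force -1 = 1 modulo \<open>N\<close>, so the sign of
        \<open>l\<close> is immaterial as well.\<close>
      then have "[- 1 = 1] (mod N)" and ll: "[- l = l'] (mod N)"
        by (auto simp: mat_cong_iff T_pow_eq)
      from cong_mult[OF cong_refl this(1), of l] have "[l = - l] (mod N)"
        by (simp add: cong_sym)
      then show ?thesis
        using ll by (rule cong_trans)
    qed (simp add: mat_cong_iff T_pow_eq)
    then have "l = l'"
      using p q by (intro eq_in_range[OF N])
    with \<open>x = y\<close> p q show ?thesis
      by simp
  qed
  show "\<exists>p\<in>set ?I. ?g p ** adj2 A \<in> pm_I (GammaN N)" if A: "A \<in> carrier SL2Z" for A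
  proof -
    obtain x B where x: "x \<in> set (index1 N kinv)" "B = A \<or> B = - A"
      "[theta x $ 2 $ 1 = B $ 2 $ 1] (mod N)" "[theta x $ 2 $ 2 = B $ 2 $ 2] (mod N)"
      using theta_row_exists[OF A] by blast
    have B: "B \<in> carrier SL2Z"
      using A x(2) by auto
    define X where "X = B ** adj2 (theta x)"
    \<comment> \<open>Modulo \<open>N\<close> such a matrix is a power of T, whose exponent may be
      taken in the range.\<close>
    have "X \<in> Gamma1 N"
      unfolding X_def using x(3,4) by (subst Gamma1_mult_adj2[OF B]) (auto intro: cong_sym)
    obtain l where l: "[l = X $ 1 $ 2] (mod N)" "- N1 N \<le> l" "l \<le> N2 N"
      using exists_in_range[OF N] by blast
    have "mat_cong N (T_pow l) X"
      using \<open>X \<in> Gamma1 N\<close> l(1) by (auto simp: mat_cong_iff T_pow_eq Gamma1_def intro: cong_sym)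
    then have "mat_cong N (T_pow l ** theta x) (X ** theta x)"
      by (intro mat_cong_mult) auto
    also have "X ** theta x = B"
      by (simp add: X_def flip: matrix_mul_assoc)
    finally have "mat_cong N (T_pow l ** theta x) B" .
    moreover have "mat_cong N (- C) A" if "mat_cong N C (- A)" for C
      using that cong_minus_minus_iff[of "- (C $ i $ j)" "A $ i $ j" N for i j]
      by (simp add: mat_cong_def)
    ultimately have "T_pow l ** theta x ** adj2 A \<in> pm_I (GammaN N)"
      using x(2) A by (auto simp: mem_pm_I_GammaN simp del: uminus_mult_2)
    then show ?thesis
      using l x(1) by (intro bexI[of _ "(l, x)"]) auto
  qed
  show "linked (?g ` set ?I) (?g p) (?g q)" if pq: "p \<in> set ?I" "q \<in> set ?I" for p q
  proof -
    let ?L = "?g ` set ?I"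
    have L: "?L \<subseteq> carrier SL2Z"
      by auto
    have mem: "T_pow l ** theta x \<in> ?L" if "- N1 N \<le> l" "l \<le> N2 N" "x \<in> set (index1 N kinv)" for l x
      using that by (intro image_eqI[of _ _ "(l, x)"]) auto
    \<comment> \<open>S^2 = -I occurs with j = m = 0, as gcd(0, N) = N > 1. Its translates form a
      chain of T edges that joins the translates of the list.\<close>
    have SS: "(1, 0, Some 0) \<in> set (index1 N kinv)" "theta (1, 0, Some 0) = - mat 1"
      using N N1_N2[OF N] by (simp_all add: set_index1[OF N] unit_rep_def mat2_eq_iff mult_nth2 matS_eq T_pow_0)
    have 1: "linked ?L (- T_pow l) (T_pow l ** theta x)"
      if l: "- N1 N \<le> l" "l \<le> N2 N" and x: "x \<in> set (index1 N kinv)" for l x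
    proof -
      have "linked ?L (T_pow l ** matS) (T_pow l ** theta x)" if "x \<in> set (index1 N kinv)" for x
        using mem l that by (intro linked_matS'[OF L]) auto
      from this[OF x] this[OF SS(1)] show ?thesis
        by (auto simp: SS(2) intro: linked_sym linked_trans simp del: Theta_elem.simps)
    qed
    have 2: "linked ?L (- T_pow l) (- T_pow l')"
      if "- N1 N \<le> l" "l \<le> N2 N" "- N1 N \<le> l'" "l' \<le> N2 N" for l l'
    proof -
      have "- mat 1 ** T_pow t \<in> ?L" if "- N1 N \<le> t" "t \<le> N2 N" for t
        using mem[OF that SS(1)] SS(2) by simp
      from linked_segment[OF L this that] show ?thesis
        by simp
    qed
    obtain l x where p: "p = (l, x)" "- N1 N \<le> l" "l \<le> N2 N" "x \<in> set (index1 N kinv)"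
      by (cases p) (use pq in auto)
    obtain l' y where q: "q = (l', y)" "- N1 N \<le> l'" "l' \<le> N2 N" "y \<in> set (index1 N kinv)"
      by (cases q) (use pq in auto)
    have "linked ?L (T_pow l ** theta x) (T_pow l' ** theta y)"
      using linked_trans[OF linked_trans[OF linked_sym[OF 1[OF p(2-4)]] 2[OF p(2,3) q(2,3)]] 1[OF q(2-4)]] .
    then show ?thesis
      by (simp only: p(1) q(1) prod.case)
  qed
qed (use N distinct_index1[OF N] in \<open>auto simp: distinct_product\<close>)

end

theorem theorem1p3:
  fixes N :: int and kinv :: "int \<Rightarrow> int"
  assumes "N > 1"
    and "\<And>k. - N1 N \<le> k \<Longrightarrow> k \<le> -2 \<Longrightarrow> gcd k N = 1 \<Longrightarrow> [k * kinv k = 1] (mod N)"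
  shows "fundamental_list (Gamma0 N) (Theta0 N) \<and>
         fundamental_list (Gamma1 N) (Theta1 N kinv) \<and>
         fundamental_list (GammaN N) (ThetaN N kinv)"
  using fundamental_list_Gamma0[OF assms] fundamental_list_Gamma1[OF assms]
    fundamental_list_GammaN[OF assms] by blast

end
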